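(* Let $n\ge2$ and let $B_\infty^n=[-1,1]^n$. Then $B_H(B_\infty^n)=B(B_\infty^n)=1$.
   Context: For an origin-symmetric convex body $K\subset\mathbb R^n$ (with non-empty interior), $B(K)$ denotes the best constant $B$ in the inequality $$\int_{\partial K}\frac{u_\nu^2(x)}{\langle x,\nu_{\partial K}(x)\rangle}\,dx\ \le\ B\int_K\|\nabla^2u\|^2dx\qquad\forall u\in\mathcal S_{0,e}(K),$$ and $B_H(K)$ denotes the best constant in the same inequality when it is only required for those $u\in\mathcal S_{0,e}(K)$ with $\Delta u=0$ in $\mathrm{int}(K)$. Here $\mathcal S_{0,e}(K)$ is the class of even functions in $C^2(\mathrm{int}(K))\cap C^1(K)$, $\nu=\nu_{\partial K}$ is the ($\mathcal H^{n-1}$-a.e. defined) unit outer normal, $u_\nu=\langle\nabla u,\nu\rangle$, $dx$ on $\partial K$ is $(n-1)$-dimensional Hausdorff measure, and $\|\cdot\|$ is the Hilbert--Schmidt norm. *)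

theory Defs
  imports "HOL-Analysis.Analysis"
begin

text \<open>
  The \<open>d\<close>-dimensional Hausdorff measure, with the normalisation under which it agrees with
  Lebesgue measure on \<open>d\<close>-dimensional affine subspaces: a covering set of diameter \<open>r\<close> is charged
  the volume of a \<open>d\<close>-dimensional ball of diameter \<open>r\<close>. The empty set is charged nothing, which
  needs saying only because of \<open>0 ^ 0 = 1\<close>.
\<close>

definition hausdorff_charge :: "nat \<Rightarrow> 'a::metric_space set \<Rightarrow> ennreal" where
  "hausdorff_charge d C =
     (if C = {} then 0 else ennreal (unit_ball_vol (real d) * (diameter C / 2) ^ d))"

definition hausdorff_content :: "nat \<Rightarrow> real \<Rightarrow> 'a::metric_space set \<Rightarrow> ennreal" where
  "hausdorff_content d \<delta> A =
     (INF C \<in> {C :: nat \<Rightarrow> 'a set. A \<subseteq> (\<Union>i. C i) \<and> (\<forall>i. bounded (C i) \<and> diameter (C i) \<le> \<delta>)}.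
        \<Sum>i. hausdorff_charge d (C i))"

definition hausdorff_outer_measure :: "nat \<Rightarrow> 'a::metric_space set \<Rightarrow> ennreal" where
  "hausdorff_outer_measure d A = (SUP \<delta>\<in>{0<..}. hausdorff_content d \<delta> A)"

text \<open>
  Hausdorff outer measure is a metric outer measure, hence countably additive on the Borel sets,
  so that \<^const>\<open>measure_of\<close> does yield its restriction to them.
\<close>

definition hausdorff_measure :: "nat \<Rightarrow> 'a::metric_space measure" where
  "hausdorff_measure d = measure_of UNIV (sets borel) (hausdorff_outer_measure d)"

text \<open>
  At a boundary point of a convex body at which the outer normal direction is not unique the
  following is unspecified; such points form a null set for the surface measure.
\<close>

definition outer_normal :: "'a::euclidean_space set \<Rightarrow> 'a \<Rightarrow> 'a" where
  "outer_normal K x = (THE v. norm v = 1 \<and> (\<forall>y\<in>K. v \<bullet> (y - x) \<le> 0))"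

text \<open>
  The derivative is taken within \<open>K\<close>. If \<open>K\<close> is convex with non-empty interior, it is unique at
  every point of \<open>K\<close>, and it is the ordinary derivative at interior points. Functions on \<open>K\<close> are
  represented by total functions, of which only the values on \<open>K\<close> matter.
\<close>

definition grad_within :: "'a::euclidean_space set \<Rightarrow> ('a \<Rightarrow> real) \<Rightarrow> 'a \<Rightarrow> 'a" where
  "grad_within K u x = (\<Sum>b\<in>Basis. frechet_derivative u (at x within K) b *\<^sub>R b)"

definition hessian :: "'a::euclidean_space set \<Rightarrow> ('a \<Rightarrow> real) \<Rightarrow> 'a \<Rightarrow> 'a \<Rightarrow> 'a" where
  "hessian K u x = frechet_derivative (grad_within K u) (at x)"

definition hessian_hs_sq :: "'a::euclidean_space set \<Rightarrow> ('a \<Rightarrow> real) \<Rightarrow> 'a \<Rightarrow> real" where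
  "hessian_hs_sq K u x = (\<Sum>b\<in>Basis. \<Sum>c\<in>Basis. (hessian K u x b \<bullet> c)\<^sup>2)"

definition laplacian :: "'a::euclidean_space set \<Rightarrow> ('a \<Rightarrow> real) \<Rightarrow> 'a \<Rightarrow> real" where
  "laplacian K u x = (\<Sum>b\<in>Basis. hessian K u x b \<bullet> b)"

text \<open>
  For a convex body \<open>K\<close>, being \<open>C\<^sup>1\<close> on \<open>K\<close> in the sense below amounts to being \<open>C\<^sup>1\<close> in the
  interior with \<open>u\<close> and its gradient extending continuously to \<open>K\<close>.
\<close>

definition C1_body :: "'a::euclidean_space set \<Rightarrow> ('a \<Rightarrow> real) \<Rightarrow> bool" where
  "C1_body K u \<longleftrightarrow> u differentiable_on K \<and> continuous_on K (grad_within K u)"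

definition C2_interior :: "'a::euclidean_space set \<Rightarrow> ('a \<Rightarrow> real) \<Rightarrow> bool" where
  "C2_interior K u \<longleftrightarrow>
     u differentiable_on interior K \<and>
     grad_within K u differentiable_on interior K \<and>
     (\<forall>b\<in>Basis. continuous_on (interior K) (\<lambda>x. hessian K u x b))"

definition S0_even :: "'a::euclidean_space set \<Rightarrow> ('a \<Rightarrow> real) set" where
  "S0_even K = {u. C2_interior K u \<and> C1_body K u \<and> (\<forall>x\<in>K. u (- x) = u x)}"

definition boundary_energy :: "'a::euclidean_space set \<Rightarrow> ('a \<Rightarrow> real) \<Rightarrow> ennreal" where
  "boundary_energy K u =
     (\<integral>\<^sup>+x\<in>frontier K. ennreal ((grad_within K u x \<bullet> outer_normal K x)\<^sup>2 / (x \<bullet> outer_normal K x))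
        \<partial>hausdorff_measure (DIM('a) - 1))"

text \<open>
  The Hessian exists in the interior only; the boundary of a convex body is a Lebesgue null set.
  The energy may be infinite.
\<close>

definition hessian_energy :: "'a::euclidean_space set \<Rightarrow> ('a \<Rightarrow> real) \<Rightarrow> ennreal" where
  "hessian_energy K u = (\<integral>\<^sup>+x\<in>interior K. ennreal (hessian_hs_sq K u x) \<partial>lborel)"

text \<open>
  The infimum is \<open>\<infinity>\<close> if no finite constant is admissible. The convention \<open>0 * \<infinity> = 0\<close> could only
  affect the admissibility of \<open>B = 0\<close>, and so never the infimum.
\<close>

definition best_constant :: "'a::euclidean_space set \<Rightarrow> ('a \<Rightarrow> real) set \<Rightarrow> ennreal" where
  "best_constant K F = Inf {B. \<forall>u\<in>F. boundary_energy K u \<le> B * hessian_energy K u}"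

definition B_const :: "'a::euclidean_space set \<Rightarrow> ennreal" where
  "B_const K = best_constant K (S0_even K)"

definition B_H_const :: "'a::euclidean_space set \<Rightarrow> ennreal" where
  "B_H_const K = best_constant K {u \<in> S0_even K. \<forall>x\<in>interior K. laplacian K u x = 0}"

definition unit_cube :: "(real ^ 'n) set" where
  "unit_cube = {x. \<forall>i. x $ i \<in> {-1..1}}"

end

theory Submission imports Defs begin

text \<open>
  On the open face \<open>x \<bullet> b = \<plusminus>1\<close> of the cube the outer normal is \<open>\<plusminus>b\<close> and \<open>\<langle>x, \<nu>\<rangle> = 1\<close>, so the boundary
  integrand is \<open>(\<partial>\<^sub>b u)\<^sup>2\<close>, while the squared norm of the Hessian is the sum over \<open>b\<close> of
  \<open>\<bar>\<nabla> \<partial>\<^sub>b u\<bar>\<^sup>2\<close>. Since \<open>u\<close> is even, each \<open>w = \<partial>\<^sub>b u\<close> is odd. The bound \<open>B \<le> 1\<close> therefore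
  follows from one inequality for an odd function \<open>w\<close> and one direction \<open>b\<close>: the integral of
  \<open>w\<^sup>2\<close> over the two faces orthogonal to \<open>b\<close> is at most the integral of \<open>\<bar>\<nabla>w\<bar>\<^sup>2\<close> over the cube
  (\<open>face_energy_le_dirichlet_energy\<close>).

  Both sides of that inequality split orthogonally into the parts of \<open>w\<close> that are even and odd
  under the reflection of a single coordinate. A function that is even in every coordinate
  and odd under \<open>x \<mapsto> -x\<close> vanishes, so after splitting coordinate by coordinate only functions
  that are odd in some coordinate \<open>j\<close> are left. If \<open>j = b\<close>, then \<open>w\<close> vanishes in the middle of each
  segment in direction \<open>b\<close>, and \<open>f(1)\<^sup>2 \<le> \<integral>\<^sub>0\<^sup>1 f'\<^sup>2\<close> whenever \<open>f(0) = 0\<close>. If \<open>j \<noteq> b\<close>, then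
  \<open>f(1)\<^sup>2 + f(-1)\<^sup>2 \<le> \<integral> f'\<^sup>2 + 2 \<integral> f\<^sup>2\<close> on the segments in direction \<open>b\<close>, and \<open>2 \<integral> f\<^sup>2 \<le> \<integral> f'\<^sup>2\<close> on the
  segments in direction \<open>j\<close>, where \<open>f(0) = 0\<close>; the two derivatives are different components of
  \<open>\<nabla>w\<close>.

  The harmonic function \<open>x\<^sub>p\<^sup>2 - x\<^sub>q\<^sup>2\<close> attains equality, which gives \<open>1 \<le> B\<^sub>H \<le> B\<close>.

  All of this presupposes that the Hausdorff measure of dimension \<open>n - 1\<close> is Lebesgue measure on
  the faces, with the constant exactly 1. It is a Borel measure because it comes from a metric outer
  measure. It dominates Lebesgue measure on a hyperplane by the isodiametric inequality, proved
  by Steiner symmetrisation along the coordinate axes. For the opposite bound, let \<open>Q\<close> be a unit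
  cube in the hyperplane and \<open>D\<close> its inscribed ball. Covering \<open>Q\<close> by small copies of
  itself, and each copy of \<open>D\<close> by itself, gives \<open>H(Q) \<le> |D| + H(Q - D)\<close>, that is, \<open>H(D) \<le> |D|\<close>;
  scaling and subtraction extend this to all bounded Borel sets
  (\<open>hausdorff_measure_eq_flat_measure\<close>).

  The dimension \<open>n - 1\<close> is not the dimension of a type here. Lebesgue measure on a hyperplane
  \<open>x \<bullet> b = c\<close> is represented by the Lebesgue measure of cylinders of height 1 in direction \<open>b\<close>.
\<close>

section \<open>Hausdorff measure is a Borel measure\<close>

lemma hausdorff_charge_mono:
  assumes "C \<subseteq> D" "bounded D"
  shows "hausdorff_charge d C \<le> hausdorff_charge d D"
proof -
  have "diameter C \<le> diameter D"
    using assms by (rule diameter_subset)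
  moreover have "0 \<le> diameter C"
    using assms bounded_subset by (intro diameter_ge_0) auto
  ultimately show ?thesis
    using assms by (auto simp: hausdorff_charge_def intro!: ennreal_leI mult_left_mono power_mono)
qed

lemma hausdorff_content_le:
  assumes "A \<subseteq> (\<Union>i. C i)" "\<And>i. bounded (C i)" "\<And>i. diameter (C i) \<le> \<delta>"
  shows "hausdorff_content d \<delta> A \<le> (\<Sum>i. hausdorff_charge d (C i))"
  unfolding hausdorff_content_def using assms by (intro INF_lower) auto

lemma hausdorff_content_le_charge:
  assumes "bounded A" "diameter A \<le> \<delta>" "0 \<le> \<delta>"
  shows "hausdorff_content d \<delta> A \<le> hausdorff_charge d A"
proof -
  define C where "C = (\<lambda>i::nat. if i = 0 then A else {})"
  have "hausdorff_content d \<delta> A \<le> (\<Sum>i. hausdorff_charge d (C i))"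
    using assms by (intro hausdorff_content_le) (auto simp: C_def split: if_splits)
  also have "\<dots> = (\<Sum>i\<in>{0}. hausdorff_charge d (C i))"
    by (rule suminf_finite) (auto simp: C_def hausdorff_charge_def)
  finally show ?thesis by (simp add: C_def)
qed

lemma hausdorff_content_mono: "A \<subseteq> B \<Longrightarrow> hausdorff_content d \<delta> A \<le> hausdorff_content d \<delta> B"
  unfolding hausdorff_content_def by (rule INF_superset_mono) auto

lemma hausdorff_content_antimono: "\<delta> \<le> \<epsilon> \<Longrightarrow> hausdorff_content d \<epsilon> A \<le> hausdorff_content d \<delta> A"
  unfolding hausdorff_content_def by (rule INF_superset_mono) (auto intro: order_trans)

text \<open>
  Near-optimal coverings of the \<open>A i\<close>, with errors \<open>e / 2\<^sup>i\<^sup>+\<^sup>1\<close>, are merged into a single sequence through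
  the pairing of natural numbers.
\<close>

lemma hausdorff_content_countable_subadditive:
  "hausdorff_content d \<delta> (\<Union>i. A i) \<le> (\<Sum>i. hausdorff_content d \<delta> (A i))"
proof (cases "(\<Sum>i. hausdorff_content d \<delta> (A i)) = \<infinity>")
  case True
  then show ?thesis by simp
next
  case False
  show ?thesis
  proof (rule ennreal_le_epsilon)
    fix e :: real assume "0 < e"
    have fin: "hausdorff_content d \<delta> (A i) < \<infinity>" for i
      using False by (metis ennreal_suminf_lessD infinity_ennreal_def less_top)
    have "\<exists>C. (A i \<subseteq> (\<Union>k. C k) \<and> (\<forall>k. bounded (C k) \<and> diameter (C k) \<le> \<delta>)) \<and>
        (\<Sum>k. hausdorff_charge d (C k)) < hausdorff_content d \<delta> (A i) + ennreal (e * (1/2)^Suc i)" for i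
    proof -
      have "hausdorff_content d \<delta> (A i) < hausdorff_content d \<delta> (A i) + ennreal (e * (1/2)^Suc i)"
        using fin[of i] \<open>0 < e\<close> by (cases "hausdorff_content d \<delta> (A i)")
          (auto simp: ennreal_plus[symmetric] ennreal_less_iff simp del: ennreal_plus power_Suc)
      then show ?thesis
        unfolding hausdorff_content_def[of d \<delta> "A i"] Inf_less_iff by blast
    qed
    then obtain C where C: "\<And>i. A i \<subseteq> (\<Union>k. C i k)" "\<And>i k. bounded (C i k)" "\<And>i k. diameter (C i k) \<le> \<delta>"
      and le: "\<And>i. (\<Sum>k. hausdorff_charge d (C i k)) < hausdorff_content d \<delta> (A i) + ennreal (e * (1/2)^Suc i)"
      by metis
    define D where "D = (\<lambda>n. case prod_decode n of (i, k) \<Rightarrow> C i k)"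
    have "(\<Union>i. A i) \<subseteq> (\<Union>n. D n)"
    proof
      fix x assume "x \<in> (\<Union>i. A i)"
      then obtain i k where "x \<in> C i k" using C(1) by blast
      then have "x \<in> D (prod_encode (i, k))" by (simp add: D_def)
      then show "x \<in> (\<Union>n. D n)" by blast
    qed
    then have "hausdorff_content d \<delta> (\<Union>i. A i) \<le> (\<Sum>n. hausdorff_charge d (D n))"
      by (rule hausdorff_content_le) (auto simp: D_def C split: prod.split)
    also have "\<dots> = (\<Sum>n. (case prod_decode n of (i, k) \<Rightarrow> hausdorff_charge d (C i k)))"
      by (intro suminf_cong) (auto simp: D_def split: prod.split)
    also have "\<dots> = (\<Sum>i. \<Sum>k. hausdorff_charge d (C i k))"
      using suminf_ennreal_2dimen[where f="\<lambda>(i, k). hausdorff_charge d (C i k)"] by simp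
    also have "\<dots> \<le> (\<Sum>i. hausdorff_content d \<delta> (A i) + ennreal (e * (1/2)^Suc i))"
      by (intro suminf_le order.strict_implies_order le) auto
    also have "\<dots> = (\<Sum>i. hausdorff_content d \<delta> (A i)) + (\<Sum>i. ennreal (e * (1/2)^Suc i))"
      by (rule suminf_add[symmetric]) auto
    also have "(\<Sum>i. ennreal (e * (1/2)^Suc i)) = ennreal e"
      using sums_mult[OF power_half_series, of e] \<open>0 < e\<close> by (intro suminf_ennreal_eq) auto
    finally show "hausdorff_content d \<delta> (\<Union>i. A i) \<le> (\<Sum>i. hausdorff_content d \<delta> (A i)) + ennreal e" .
  qed
qed

lemma hausdorff_content_Un: "0 \<le> \<delta> \<Longrightarrow>
  hausdorff_content d \<delta> (A \<union> B) \<le> hausdorff_content d \<delta> A + hausdorff_content d \<delta> B"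
proof -
  assume "0 \<le> \<delta>"
  have e: "hausdorff_content d \<delta> ({} :: 'a set) \<le> 0"
    using hausdorff_content_le_charge[of "{}" \<delta> d] \<open>0 \<le> \<delta>\<close> by (simp add: hausdorff_charge_def)
  define F where "F = (\<lambda>i::nat. if i = 0 then A else if i = 1 then B else {})"
  have "A \<union> B = (\<Union>i. F i)" by (auto simp: F_def)
  then have "hausdorff_content d \<delta> (A \<union> B) \<le> (\<Sum>i. hausdorff_content d \<delta> (F i))"
    using hausdorff_content_countable_subadditive by metis
  also have "\<dots> = (\<Sum>i\<in>{0,1}. hausdorff_content d \<delta> (F i))"
    using e by (intro suminf_finite) (auto simp: F_def)
  finally show ?thesis by (simp add: F_def)
qed

lemma hausdorff_content_UN:
  assumes "finite I" "0 \<le> \<delta>"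
  shows "hausdorff_content d \<delta> (\<Union>i\<in>I. A i) \<le> (\<Sum>i\<in>I. hausdorff_content d \<delta> (A i))"
  using assms(1)
proof induction
  case empty
  then show ?case
    using hausdorff_content_le_charge[of "{}" \<delta> d] \<open>0 \<le> \<delta>\<close> by (simp add: hausdorff_charge_def)
next
  case (insert i I)
  have "hausdorff_content d \<delta> (\<Union>i\<in>insert i I. A i)
      \<le> hausdorff_content d \<delta> (A i) + hausdorff_content d \<delta> (\<Union>i\<in>I. A i)"
    using hausdorff_content_Un[OF assms(2)] by simp
  also have "\<dots> \<le> hausdorff_content d \<delta> (A i) + (\<Sum>i\<in>I. hausdorff_content d \<delta> (A i))"
    using insert by (intro add_left_mono)
  finally show ?case using insert by simp
qed

lemma hausdorff_content_le_outer: "0 < \<delta> \<Longrightarrow> hausdorff_content d \<delta> A \<le> hausdorff_outer_measure d A"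
  unfolding hausdorff_outer_measure_def by (rule SUP_upper) auto

lemma hausdorff_outer_measure_mono: "A \<subseteq> B \<Longrightarrow> hausdorff_outer_measure d A \<le> hausdorff_outer_measure d B"
  unfolding hausdorff_outer_measure_def by (intro SUP_mono) (auto intro: hausdorff_content_mono)

lemma hausdorff_outer_measure_empty: "hausdorff_outer_measure d {} = 0"
proof -
  have "hausdorff_outer_measure d ({} :: 'a set) \<le> 0"
    unfolding hausdorff_outer_measure_def
  proof (rule SUP_least)
    fix \<delta> :: real assume "\<delta> \<in> {0<..}"
    then show "hausdorff_content d \<delta> ({} :: 'a set) \<le> 0"
      using hausdorff_content_le_charge[of "{}" \<delta> d] by (simp add: hausdorff_charge_def)
  qed
  then show ?thesis by simp
qed

lemma hausdorff_outer_measure_countable_subadditive: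
  "hausdorff_outer_measure d (\<Union>i. A i) \<le> (\<Sum>i. hausdorff_outer_measure d (A i))"
  unfolding hausdorff_outer_measure_def[of d "\<Union>i. A i"]
proof (rule SUP_least)
  fix \<delta> :: real assume "\<delta> \<in> {0<..}"
  have "hausdorff_content d \<delta> (\<Union>i. A i) \<le> (\<Sum>i. hausdorff_content d \<delta> (A i))"
    by (rule hausdorff_content_countable_subadditive)
  also have "\<dots> \<le> (\<Sum>i. hausdorff_outer_measure d (A i))"
    using \<open>\<delta> \<in> {0<..}\<close> by (intro suminf_le hausdorff_content_le_outer) auto
  finally show "hausdorff_content d \<delta> (\<Union>i. A i) \<le> (\<Sum>i. hausdorff_outer_measure d (A i))" .
qed

lemma hausdorff_outer_measure_Un:
  "hausdorff_outer_measure d (A \<union> B) \<le> hausdorff_outer_measure d A + hausdorff_outer_measure d B"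
proof -
  define F where "F = (\<lambda>i::nat. if i = 0 then A else if i = 1 then B else {})"
  have "A \<union> B = (\<Union>i. F i)" by (auto simp: F_def)
  then have "hausdorff_outer_measure d (A \<union> B) \<le> (\<Sum>i. hausdorff_outer_measure d (F i))"
    using hausdorff_outer_measure_countable_subadditive by metis
  also have "\<dots> = (\<Sum>i\<in>{0,1}. hausdorff_outer_measure d (F i))"
    by (intro suminf_finite) (auto simp: F_def hausdorff_outer_measure_empty)
  finally show ?thesis by (simp add: F_def)
qed

text \<open>
  A covering set of diameter less than the distance between two sets meets at most one of them, so
  a fine covering of the union splits into coverings of the two sets.
\<close>

lemma hausdorff_outer_measure_metric:
  fixes A B :: "'a::metric_space set"
  assumes "0 < e" and sep: "\<And>x y. x \<in> A \<Longrightarrow> y \<in> B \<Longrightarrow> e \<le> dist x y"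
  shows "hausdorff_outer_measure d A + hausdorff_outer_measure d B \<le> hausdorff_outer_measure d (A \<union> B)"
proof -
  have split: "hausdorff_content d \<delta> A + hausdorff_content d \<delta> B \<le> hausdorff_content d \<delta> (A \<union> B)"
    if "0 < \<delta>" "\<delta> < e" for \<delta>
    unfolding hausdorff_content_def[of d \<delta> "A \<union> B"]
  proof (rule INF_greatest)
    fix C :: "nat \<Rightarrow> 'a set"
    assume "C \<in> {C. A \<union> B \<subseteq> (\<Union>i. C i) \<and> (\<forall>i. bounded (C i) \<and> diameter (C i) \<le> \<delta>)}"
    then have C: "A \<union> B \<subseteq> (\<Union>i. C i)" "\<And>i. bounded (C i)" "\<And>i. diameter (C i) \<le> \<delta>" by auto
    have b: "bounded (C i \<inter> A)" "bounded (C i \<inter> B)" for i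
      using C(2) by auto
    have dm: "diameter (C i \<inter> A) \<le> \<delta>" "diameter (C i \<inter> B) \<le> \<delta>" for i
      using C(3)[of i] diameter_subset[OF _ C(2), of "C i \<inter> A" i] diameter_subset[OF _ C(2), of "C i \<inter> B" i]
      by auto
    have le: "hausdorff_charge d (C i \<inter> A) + hausdorff_charge d (C i \<inter> B) \<le> hausdorff_charge d (C i)" for i
    proof -
      have "C i \<inter> A = {} \<or> C i \<inter> B = {}"
      proof (rule ccontr)
        assume "\<not> ?thesis"
        then obtain x y where "x \<in> C i" "x \<in> A" "y \<in> C i" "y \<in> B" by blast
        then show False
          using sep[of x y] diameter_bounded_bound[OF C(2), of x i y] C(3)[of i] that by auto
      qed
      then show ?thesis
        using hausdorff_charge_mono[OF _ C(2), of "C i \<inter> A" i d] hausdorff_charge_mono[OF _ C(2), of "C i \<inter> B" i d]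
        by (auto simp: hausdorff_charge_def[of d "{}"])
    qed
    have "hausdorff_content d \<delta> A + hausdorff_content d \<delta> B
        \<le> (\<Sum>i. hausdorff_charge d (C i \<inter> A)) + (\<Sum>i. hausdorff_charge d (C i \<inter> B))"
      using C by (intro add_mono hausdorff_content_le b dm) auto
    also have "\<dots> = (\<Sum>i. hausdorff_charge d (C i \<inter> A) + hausdorff_charge d (C i \<inter> B))"
      by (rule suminf_add) auto
    also have "\<dots> \<le> (\<Sum>i. hausdorff_charge d (C i))"
      by (intro suminf_le le) auto
    finally show "hausdorff_content d \<delta> A + hausdorff_content d \<delta> B \<le> (\<Sum>i. hausdorff_charge d (C i))" .
  qed
  have "hausdorff_content d \<delta> A + hausdorff_content d \<delta>' B \<le> hausdorff_outer_measure d (A \<union> B)"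
    if "0 < \<delta>" "0 < \<delta>'" for \<delta> \<delta>'
  proof -
    \<comment> \<open>Fine enough for both given scales and for the distance between the sets.\<close>
    define \<eta> where "\<eta> = min (min \<delta> \<delta>') (e/2)"
    have \<eta>: "0 < \<eta>" "\<eta> < e" "\<eta> \<le> \<delta>" "\<eta> \<le> \<delta>'" using that \<open>0 < e\<close> by (auto simp: \<eta>_def)
    have "hausdorff_content d \<delta> A + hausdorff_content d \<delta>' B \<le> hausdorff_content d \<eta> A + hausdorff_content d \<eta> B"
      using \<eta> by (intro add_mono hausdorff_content_antimono)
    also have "\<dots> \<le> hausdorff_outer_measure d (A \<union> B)"
      using split[OF \<eta>(1,2)] hausdorff_content_le_outer[OF \<eta>(1)] order_trans by blast
    finally show ?thesis .
  qed
  then have "hausdorff_content d \<delta> A + hausdorff_outer_measure d B \<le> hausdorff_outer_measure d (A \<union> B)"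
    if "0 < \<delta>" for \<delta>
    unfolding hausdorff_outer_measure_def[of d B] using that
    by (subst ennreal_SUP_add_right) (auto intro!: SUP_least)
  then show ?thesis
    unfolding hausdorff_outer_measure_def[of d A]
    by (subst ennreal_SUP_add_left[symmetric]) (auto intro!: SUP_least)
qed

text \<open>
  Caratheodory's criterion. The part of \<open>T\<close> at distance at least \<open>a k\<close> from the complement of \<open>U\<close> is
  separated from \<open>T - U\<close>, so there the metric property applies. What is left of \<open>T \<inter> U\<close> is the
  union of the thin distance shells \<open>R k\<close>. Shells whose indices differ by at least two are separated, so
  the measures of the even shells have a sum of at most \<open>H(T)\<close>, and so do those of the odd shells.
  Hence the tails of the series tend to 0 if \<open>H(T)\<close> is finite; otherwise the bound is trivial.
\<close>

lemma open_in_lambda_system_hausdorff: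
  fixes U :: "'a::metric_space set"
  assumes "open U"
  shows "U \<in> lambda_system UNIV UNIV (hausdorff_outer_measure d)"
proof -
  let ?H = "hausdorff_outer_measure d :: 'a set \<Rightarrow> ennreal"
  have main: "?H (U \<inter> T) + ?H (T - U) \<le> ?H T" for T
  proof (cases "?H T = \<infinity> \<or> U = UNIV")
    case True
    then show ?thesis by (auto simp: hausdorff_outer_measure_empty)
  next
    case False
    then have fin: "?H T < \<infinity>" and ne: "- U \<noteq> {}" by (auto simp: less_top)
    define f where "f = (\<lambda>x. infdist x (- U))"
    have f_pos: "x \<in> U \<longleftrightarrow> 0 < f x" for x
    proof -
      have "x \<in> - U \<longleftrightarrow> f x = 0"
        unfolding f_def using assms ne by (intro in_closed_iff_infdist_zero) auto
      then show ?thesis using infdist_nonneg[of x "-U"] by (auto simp: f_def less_le)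
    qed
    have lip: "f x \<le> f y + dist x y" for x y unfolding f_def by (rule infdist_triangle)
    define a where "a = (\<lambda>k::nat. 1 / real (Suc k))"
    have a_pos: "0 < a k" for k by (auto simp: a_def)
    have a_less: "a l < a k" if "k < l" for k l using that by (auto simp: a_def field_simps)
    have a_le: "a l \<le> a k" if "k \<le> l" for k l using that by (auto simp: a_def field_simps)
    define S where "S = (\<lambda>k. {x\<in>T. a k \<le> f x})"
    define R where "R = (\<lambda>k. {x\<in>T. a (Suc k) \<le> f x \<and> f x < a k})"
    have sep_sum: "(\<Sum>i<n. ?H (R (2*i + p))) \<le> ?H (\<Union>i<n. R (2*i+p))" for p n
    proof (induction n)
      case (Suc n)
      have "?H (\<Union>i<n. R (2*i+p)) + ?H (R (2*n+p)) \<le> ?H ((\<Union>i<n. R (2*i+p)) \<union> R (2*n+p))"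
      proof (cases "n = 0")
        case False
        show ?thesis
        proof (rule hausdorff_outer_measure_metric[where e="a (2*n+p-1) - a (2*n+p)"])
          show "0 < a (2*n+p-1) - a (2*n+p)" using a_less[of "2*n+p-1" "2*n+p"] False by auto
          fix x y assume "x \<in> (\<Union>i<n. R (2*i+p))" "y \<in> R (2*n+p)"
          then obtain i where i: "i < n" "a (Suc (2*i+p)) \<le> f x" "f y < a (2*n+p)" by (auto simp: R_def)
          have "a (2*n+p-1) \<le> a (Suc (2*i+p))" using i by (intro a_le) auto
          then show "a (2*n+p-1) - a (2*n+p) \<le> dist x y" using lip[of x y] i by auto
        qed
      qed (auto simp: hausdorff_outer_measure_empty)
      also have "(\<Union>i<n. R (2*i+p)) \<union> R (2*n+p) = (\<Union>i<Suc n. R (2*i+p))"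
        by (auto simp: lessThan_Suc)
      finally show ?case
        using order_trans[OF add_right_mono[OF Suc, of "?H (R (2*n+p))"]]
        by (simp only: sum.lessThan_Suc)
    qed simp
    have bound: "(\<Sum>i. ?H (R (2*i+p))) \<le> ?H T" for p
    proof (rule suminf_le_const)
      show "(\<Sum>i<n. ?H (R (2*i+p))) \<le> ?H T" for n
        by (rule order_trans[OF sep_sum hausdorff_outer_measure_mono]) (auto simp: R_def)
    qed auto
    define G where "G = (\<lambda>i. ?H (R (2*i+0)) + ?H (R (2*i+1)))"
    have "(\<Sum>i. G i) = (\<Sum>i. ?H (R (2*i+0))) + (\<Sum>i. ?H (R (2*i+1)))"
      unfolding G_def by (rule suminf_add[symmetric]) auto
    also have "\<dots> \<le> ?H T + ?H T" by (intro add_mono bound)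
    also have "\<dots> < \<infinity>" using fin by (auto simp: ennreal_add_less_top)
    finally have Gfin: "(\<Sum>i. G i) < \<infinity>" .
    have TU: "U \<inter> T \<subseteq> S (2*n) \<union> (\<Union>i. R (2*(i+n)+0) \<union> R (2*(i+n)+1))" for n
    proof
      fix x assume x: "x \<in> U \<inter> T"
      show "x \<in> S (2*n) \<union> (\<Union>i. R (2*(i+n)+0) \<union> R (2*(i+n)+1))"
      proof (cases "a (2*n) \<le> f x")
        case False
        obtain m where "1 / f x < real m" using reals_Archimedean2 by blast
        then have "a m \<le> f x" using x f_pos[of x] by (auto simp: a_def field_simps)
        define k where "k = (LEAST k. a k \<le> f x)"
        have k: "a k \<le> f x" unfolding k_def using \<open>a m \<le> f x\<close> by (rule LeastI)
        have "2*n < k" using False k a_le[of k "2*n"] by (meson leI order_trans)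
        then obtain j where j: "k = Suc j" "2*n \<le> j" by (cases k) auto
        have "\<not> a j \<le> f x" using not_less_Least[of j "\<lambda>k. a k \<le> f x"] j by (auto simp: k_def[symmetric])
        then have xR: "x \<in> R j" using x k j by (auto simp: R_def)
        define i where "i = j div 2 - n"
        have "j = 2 * (i + n) + 0 \<or> j = 2 * (i + n) + 1" unfolding i_def using j(2) by presburger
        then have "x \<in> R (2 * (i + n) + 0) \<union> R (2 * (i + n) + 1)"
          using xR by (metis UnI1 UnI2)
        then show ?thesis by blast
      qed (use x in \<open>auto simp: S_def\<close>)
    qed
    have "?H (U \<inter> T) + ?H (T - U) \<le> ?H T + (\<Sum>i. G (i+n))" for n
    proof -
      have "?H (U \<inter> T) \<le> ?H (S (2*n)) + ?H (\<Union>i. R (2*(i+n)+0) \<union> R (2*(i+n)+1))"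
        using hausdorff_outer_measure_mono[OF TU, of d n] hausdorff_outer_measure_Un order_trans by blast
      also have "\<dots> \<le> ?H (S (2*n)) + (\<Sum>i. ?H (R (2*(i+n)+0) \<union> R (2*(i+n)+1)))"
        by (intro add_left_mono hausdorff_outer_measure_countable_subadditive)
      also have "\<dots> \<le> ?H (S (2*n)) + (\<Sum>i. G (i+n))"
        unfolding G_def by (intro add_left_mono suminf_le hausdorff_outer_measure_Un) auto
      finally have 1: "?H (U \<inter> T) \<le> ?H (S (2*n)) + (\<Sum>i. G (i+n))" .
      have "?H (S (2*n)) + ?H (T - U) \<le> ?H (S (2*n) \<union> (T - U))"
      proof (rule hausdorff_outer_measure_metric[OF a_pos[of "2*n"]])
        fix x y assume "x \<in> S (2*n)" "y \<in> T - U"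
        then show "a (2*n) \<le> dist x y" using lip[of x y] f_pos[of y] by (auto simp: S_def)
      qed
      also have "\<dots> \<le> ?H T" by (rule hausdorff_outer_measure_mono) (auto simp: S_def)
      finally have 2: "?H (S (2*n)) + ?H (T - U) \<le> ?H T" .
      have "?H (U \<inter> T) + ?H (T - U) \<le> ?H (S (2*n)) + (\<Sum>i. G (i+n)) + ?H (T - U)"
        using 1 by (rule add_right_mono)
      also have "\<dots> = (?H (S (2*n)) + ?H (T - U)) + (\<Sum>i. G (i+n))" by (simp add: ac_simps)
      also have "\<dots> \<le> ?H T + (\<Sum>i. G (i+n))" using 2 by (rule add_right_mono)
      finally show ?thesis .
    qed
    moreover have "(\<lambda>n. ?H T + (\<Sum>i. G (i+n))) \<longlonglongrightarrow> ?H T + 0"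
    proof (intro tendsto_add tendsto_const)
      define g where "g = (\<lambda>i. enn2real (G i))"
      have Gi: "G i < \<infinity>" for i using Gfin by (metis ennreal_suminf_lessD infinity_ennreal_def)
      have G: "G i = ennreal (g i)" for i using Gi[of i] by (auto simp: g_def)
      have sg: "summable g"
        using Gfin unfolding G by (intro summable_suminf_not_top) (auto simp: g_def)
      have "(\<lambda>n. ennreal (\<Sum>i. g (i+n))) \<longlonglongrightarrow> ennreal 0"
        by (intro tendsto_ennrealI suminf_exist_split2 sg)
      moreover have "(\<Sum>i. G (i+n)) = ennreal (\<Sum>i. g (i+n))" for n
        unfolding G using sg summable_iff_shift[of g n] by (intro suminf_ennreal2) (auto simp: g_def)
      ultimately show "(\<lambda>n. \<Sum>i. G (i+n)) \<longlonglongrightarrow> 0" by simp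
    qed
    ultimately show ?thesis
      by (metis (no_types, lifting) LIMSEQ_le_const add.right_neutral)
  qed
  interpret algebra UNIV "UNIV :: 'a set set" by (metis Pow_UNIV algebra_Pow)
  show ?thesis
    unfolding lambda_system_eq
  proof (intro CollectI conjI ballI UNIV_I antisym)
    fix T :: "'a set"
    show "?H (T \<inter> U) + ?H (T - U) \<le> ?H T" using main[of T] by (simp add: Int_commute)
    have "T = (T \<inter> U) \<union> (T - U)" by blast
    then show "?H T \<le> ?H (T \<inter> U) + ?H (T - U)" by (metis hausdorff_outer_measure_Un)
  qed
qed

lemma sets_hausdorff_measure [simp, measurable_cong]: "sets (hausdorff_measure d) = sets borel"
proof -
  have "sigma_sets UNIV (sets borel) = sets (borel :: 'a measure)"
    using sets.sigma_sets_eq[of "borel :: 'a measure"] by simp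
  then show ?thesis by (simp add: hausdorff_measure_def)
qed

lemma emeasure_hausdorff_measure:
  fixes A :: "'a::metric_space set"
  assumes "A \<in> sets borel"
  shows "emeasure (hausdorff_measure d) A = hausdorff_outer_measure d A"
proof -
  let ?H = "hausdorff_outer_measure d :: 'a set \<Rightarrow> ennreal"
  let ?L = "lambda_system UNIV UNIV ?H"
  interpret sigma_algebra UNIV "UNIV :: 'a set set" by (metis Pow_UNIV sigma_algebra_Pow)
  have oms: "outer_measure_space UNIV ?H"
    by (auto simp: outer_measure_space_def positive_def increasing_def countably_subadditive_def
        hausdorff_outer_measure_empty hausdorff_outer_measure_mono
        hausdorff_outer_measure_countable_subadditive)
  have ms: "measure_space UNIV ?L ?H" by (rule caratheodory_lemma[OF oms])
  then interpret L: sigma_algebra UNIV ?L by (simp add: measure_space_def)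
  have sub: "sets borel \<subseteq> ?L"
    unfolding borel_def
    by (auto intro!: L.sigma_sets_subset subsetD[OF L.sigma_sets_subset] open_in_lambda_system_hausdorff)
  have "countably_additive (sets borel) ?H"
    using ms sub unfolding measure_space_def countably_additive_def by blast
  moreover have "positive (sets borel) ?H" by (simp add: positive_def hausdorff_outer_measure_empty)
  ultimately show ?thesis
    using emeasure_measure_of[OF hausdorff_measure_def, of d A] assms
    by (simp)
qed

lemma lipschitz_image_diameter:
  fixes f :: "'a::metric_space \<Rightarrow> 'b::metric_space"
  assumes "0 < L" and lip: "\<And>x y. dist (f x) (f y) \<le> L * dist x y" and "bounded C"
  shows "bounded (f ` C)" "diameter (f ` C) \<le> L * diameter C"
proof -
  have D: "dist (f x) (f y) \<le> L * diameter C" if "x \<in> C" "y \<in> C" for x y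
    using lip[of x y] diameter_bounded_bound[OF \<open>bounded C\<close> that] \<open>0 < L\<close>
    by (smt (verit) mult_le_cancel_left_pos)
  then show "bounded (f ` C)" by (auto simp: bounded_two_points)
  show "diameter (f ` C) \<le> L * diameter C"
    using D diameter_ge_0[OF \<open>bounded C\<close>] \<open>0 < L\<close>
    by (auto simp: diameter_def[of "f ` C"] intro!: cSUP_least)
qed

lemma hausdorff_charge_lipschitz_image:
  fixes f :: "'a::metric_space \<Rightarrow> 'b::metric_space"
  assumes "0 < L" and lip: "\<And>x y. dist (f x) (f y) \<le> L * dist x y" and "bounded C"
  shows "hausdorff_charge d (f ` C) \<le> ennreal (L ^ d) * hausdorff_charge d C"
proof (cases "C = {}")
  case False
  have "(diameter (f ` C) / 2) ^ d \<le> (L * (diameter C / 2)) ^ d"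
    using lipschitz_image_diameter[OF assms] diameter_ge_0 by (intro power_mono) auto
  also have "\<dots> = L ^ d * (diameter C / 2) ^ d" by (rule power_mult_distrib)
  finally have "(diameter (f ` C) / 2) ^ d \<le> L ^ d * (diameter C / 2) ^ d" .
  then have "unit_ball_vol (real d) * (diameter (f ` C) / 2) ^ d
      \<le> L ^ d * (unit_ball_vol (real d) * (diameter C / 2) ^ d)"
    by (simp add: mult_left_mono mult.left_commute)
  then show ?thesis
    using False \<open>0 < L\<close> by (auto simp: hausdorff_charge_def ennreal_mult'[symmetric] intro!: ennreal_leI)
qed (simp add: hausdorff_charge_def)

text \<open>
  The form in which translations and homotheties of sets are used below: a homothety is Lipschitz with
  its ratio as the constant.
\<close>

lemma hausdorff_outer_measure_lipschitz_image:
  fixes f :: "'a::metric_space \<Rightarrow> 'b::metric_space"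
  assumes "0 < L" and lip: "\<And>x y. dist (f x) (f y) \<le> L * dist x y"
  shows "hausdorff_outer_measure d (f ` A) \<le> ennreal (L ^ d) * hausdorff_outer_measure d A"
proof -
  note img = lipschitz_image_diameter[OF assms]
  have content: "hausdorff_content d (L * \<delta>) (f ` A) \<le> ennreal (L ^ d) * hausdorff_content d \<delta> A" for \<delta>
  proof -
    have inv: "ennreal (L ^ d) * (ennreal (inverse (L ^ d)) * x) = x" 
      "ennreal (inverse (L ^ d)) * (ennreal (L ^ d) * x) = x" for x
      using \<open>0 < L\<close> by (simp_all add: mult.assoc[symmetric] ennreal_mult''[symmetric])
    have "ennreal (inverse (L ^ d)) * hausdorff_content d (L * \<delta>) (f ` A) \<le> hausdorff_content d \<delta> A"
      unfolding hausdorff_content_def[of d \<delta> A]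
    proof (rule INF_greatest)
      fix C :: "nat \<Rightarrow> 'a set"
      assume "C \<in> {C. A \<subseteq> (\<Union>i. C i) \<and> (\<forall>i. bounded (C i) \<and> diameter (C i) \<le> \<delta>)}"
      then have C: "A \<subseteq> (\<Union>i. C i)" "\<And>i. bounded (C i)" "\<And>i. diameter (C i) \<le> \<delta>" by auto
      have "diameter (f ` C i) \<le> L * \<delta>" for i
        using img(2)[OF C(2), of i] C(3)[of i] \<open>0 < L\<close> by (smt (verit) mult_le_cancel_left_pos)
      then have "hausdorff_content d (L * \<delta>) (f ` A) \<le> (\<Sum>i. hausdorff_charge d (f ` C i))"
        using img[OF C(2)] image_mono[OF C(1), of f]
        by (intro hausdorff_content_le) (simp_all add: image_UN)
      also have "\<dots> \<le> (\<Sum>i. ennreal (L ^ d) * hausdorff_charge d (C i))"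
        by (intro suminf_le hausdorff_charge_lipschitz_image assms C) auto
      also have "\<dots> = ennreal (L ^ d) * (\<Sum>i. hausdorff_charge d (C i))" by simp
      finally show "ennreal (inverse (L ^ d)) * hausdorff_content d (L * \<delta>) (f ` A)
          \<le> (\<Sum>i. hausdorff_charge d (C i))"
        by (metis inv(2) mult_left_mono zero_le)
    qed
    then show ?thesis by (metis inv(1) mult_left_mono zero_le)
  qed
  show ?thesis
    unfolding hausdorff_outer_measure_def[of d "f ` A"]
  proof (rule SUP_least)
    fix \<delta> :: real assume "\<delta> \<in> {0<..}"
    then have "hausdorff_content d (L * (\<delta>/L)) (f ` A) \<le> ennreal (L^d) * hausdorff_outer_measure d A"
      using \<open>0 < L\<close> by (intro order_trans[OF content] mult_left_mono hausdorff_content_le_outer) auto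
    then show "hausdorff_content d \<delta> (f ` A) \<le> ennreal (L^d) * hausdorff_outer_measure d A"
      using \<open>0 < L\<close> by simp
  qed
qed

section \<open>Slicing along a coordinate and the isodiametric inequality\<close>

definition coord_upd :: "'a::euclidean_space \<Rightarrow> real \<Rightarrow> 'a \<Rightarrow> 'a" where
  "coord_upd b s x = x + (s - x \<bullet> b) *\<^sub>R b"

lemma inner_coord_upd:
  "b \<in> Basis \<Longrightarrow> k \<in> Basis \<Longrightarrow> coord_upd b s x \<bullet> k = (if k = b then s else x \<bullet> k)"
  by (auto simp: coord_upd_def inner_left_distrib inner_Basis)

lemma coord_upd_coord_upd [simp]: "b \<in> Basis \<Longrightarrow> coord_upd b s (coord_upd b t x) = coord_upd b s x"
  by (auto simp: coord_upd_def algebra_simps)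

lemma coord_upd_self [simp]: "coord_upd b (x \<bullet> b) x = x"
  by (simp add: coord_upd_def)

lemma measurable_coord_upd [measurable (raw)]:
  assumes [measurable]: "f \<in> borel_measurable M" "g \<in> borel_measurable M"
  shows "(\<lambda>x. coord_upd b (f x) (g x)) \<in> borel_measurable M"
  unfolding coord_upd_def by measurable

lemma nn_integral_lborel_translate:
  fixes f :: "'a::euclidean_space \<Rightarrow> ennreal"
  assumes [measurable]: "f \<in> borel_measurable borel"
  shows "(\<integral>\<^sup>+x. f (a + x) \<partial>lborel) = (\<integral>\<^sup>+x. f x \<partial>lborel)"
proof -
  have "(\<integral>\<^sup>+x. f x \<partial>lborel) = (\<integral>\<^sup>+x. f x \<partial>(distr lborel borel ((+) a)))"
    by (subst lborel_distr_plus) simp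
  also have "\<dots> = (\<integral>\<^sup>+x. f (a + x) \<partial>lborel)" by (rule nn_integral_distr) auto
  finally show ?thesis ..
qed

text \<open>
  Fubini in direction \<open>b\<close>. The outer integral runs over a slab of height 1 instead of a hyperplane, so
  that every integral is over the whole space. The proof needs only translation invariance
  and the exchange of two integrals: the line through \<open>x\<close> is parametrised from \<open>x\<close>, and a translation
  moves the slab instead of the argument of \<open>f\<close>.
\<close>

lemma nn_integral_lborel_slice:
  fixes f :: "'a::euclidean_space \<Rightarrow> ennreal"
  assumes b: "b \<in> Basis" and [measurable]: "f \<in> borel_measurable borel"
  shows "(\<integral>\<^sup>+x. f x \<partial>lborel) = (\<integral>\<^sup>+x. indicator {0..1} (x \<bullet> b) * (\<integral>\<^sup>+s. f (coord_upd b s x) \<partial>lborel) \<partial>lborel)"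
proof -
  have bb: "b \<bullet> b = 1" using b by simp
  have 1: "(\<integral>\<^sup>+s. f (coord_upd b s x) \<partial>lborel) = (\<integral>\<^sup>+s. f (s *\<^sub>R b + x) \<partial>lborel)" for x
    by (subst nn_integral_real_affine[where c=1 and t="x \<bullet> b"]) (auto simp: coord_upd_def add.commute)
  have 2: "(\<integral>\<^sup>+s. indicator {0..1} (x \<bullet> b - s) \<partial>lborel) = (1::ennreal)" for x
  proof -
    have "(\<integral>\<^sup>+s. indicator {0..1} (x \<bullet> b - s) \<partial>lborel) = (\<integral>\<^sup>+s. indicator {x \<bullet> b - 1..x \<bullet> b} s \<partial>lborel)"
      by (intro nn_integral_cong) (auto simp: indicator_def)
    also have "\<dots> = 1" by (subst nn_integral_indicator) auto
    finally show ?thesis .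
  qed
  have "(\<integral>\<^sup>+x. indicator {0..1} (x \<bullet> b) * (\<integral>\<^sup>+s. f (coord_upd b s x) \<partial>lborel) \<partial>lborel)
      = (\<integral>\<^sup>+x. \<integral>\<^sup>+s. indicator {0..1} (x \<bullet> b) * f (s *\<^sub>R b + x) \<partial>lborel \<partial>lborel)"
    unfolding 1 by (intro nn_integral_cong nn_integral_cmult[symmetric]) measurable
  also have "\<dots> = (\<integral>\<^sup>+s. \<integral>\<^sup>+x. indicator {0..1} (x \<bullet> b) * f (s *\<^sub>R b + x) \<partial>lborel \<partial>lborel)"
    by (rule lborel_pair.Fubini') measurable
  also have "\<dots> = (\<integral>\<^sup>+s. \<integral>\<^sup>+x. indicator {0..1} (x \<bullet> b - s) * f x \<partial>lborel \<partial>lborel)"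
  proof (rule nn_integral_cong)
    fix s :: real
    show "(\<integral>\<^sup>+x. indicator {0..1} (x \<bullet> b) * f (s *\<^sub>R b + x) \<partial>lborel)
        = (\<integral>\<^sup>+x. indicator {0..1} (x \<bullet> b - s) * f x \<partial>lborel)"
      by (subst nn_integral_lborel_translate[where a="s *\<^sub>R b", symmetric]) (auto simp: inner_left_distrib bb)
  qed
  also have "\<dots> = (\<integral>\<^sup>+x. \<integral>\<^sup>+s. indicator {0..1} (x \<bullet> b - s) * f x \<partial>lborel \<partial>lborel)"
    by (rule lborel_pair.Fubini') measurable
  also have "\<dots> = (\<integral>\<^sup>+x. (\<integral>\<^sup>+s. indicator {0..1} (x \<bullet> b - s) \<partial>lborel) * f x \<partial>lborel)"
    by (intro nn_integral_cong nn_integral_multc) measurable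
  finally show ?thesis by (simp add: 2)
qed

lemma emeasure_lborel_cylinder_ball:
  fixes b m :: "'a::euclidean_space"
  assumes b: "b \<in> Basis" and r: "0 < r"
  shows "emeasure lborel {x. x \<bullet> b \<in> {0..1} \<and> (\<Sum>k\<in>Basis-{b}. ((x - m) \<bullet> k)\<^sup>2) \<le> r\<^sup>2}
    = ennreal (unit_ball_vol (real (DIM('a) - 1)) * r ^ (DIM('a) - 1))" (is "emeasure _ ?A = _")
proof -
  interpret product_sigma_finite "\<lambda>_::'a. lborel :: real measure" ..
  let ?I = "Basis - {b} :: 'a set"
  let ?C = "{x::'a. x \<bullet> b \<in> {0..1} \<and> (\<Sum>k\<in>?I. (x \<bullet> k)\<^sup>2) \<le> r\<^sup>2}"
  let ?B = "{f. sqrt (\<Sum>i\<in>?I. (f i)\<^sup>2) \<le> r} \<inter> space (Pi\<^sub>M ?I (\<lambda>_. lborel))"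
  define m' where "m' = m - (m \<bullet> b) *\<^sub>R b"
  have m': "m' \<bullet> b = 0" "k \<in> ?I \<Longrightarrow> m' \<bullet> k = m \<bullet> k" for k
    using b by (auto simp: m'_def inner_diff_left inner_Basis)
  have ins: "insert b ?I = Basis" using b by auto
  have sq: "sqrt (\<Sum>i\<in>?I. (f i)\<^sup>2) \<le> r \<longleftrightarrow> (\<Sum>i\<in>?I. (f i)\<^sup>2) \<le> r\<^sup>2" for f :: "'a \<Rightarrow> real"
    using r by (simp add: real_sqrt_le_iff' sum_nonneg)
  have [measurable]: "?B \<in> sets (Pi\<^sub>M ?I (\<lambda>_. lborel))" by measurable
  have pt: "indicator ?C (\<Sum>k\<in>Basis. (f(b := y)) k *\<^sub>R k) = (indicator ?B f * indicator {0..1} y :: ennreal)"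
    if f: "f \<in> space (Pi\<^sub>M ?I (\<lambda>_. lborel :: real measure))" for f :: "'a \<Rightarrow> real" and y :: real
  proof -
    have "(\<Sum>k\<in>?I. ((\<Sum>j\<in>Basis. (f(b := y)) j *\<^sub>R j) \<bullet> k)\<^sup>2) = (\<Sum>k\<in>?I. (f k)\<^sup>2)"
      by (intro sum.cong) auto
    then show ?thesis using f b by (auto simp: indicator_def sq)
  qed
  have "emeasure lborel ?A = (\<integral>\<^sup>+x. indicator ?A x \<partial>lborel)"
    by (subst nn_integral_indicator) auto
  also have "\<dots> = (\<integral>\<^sup>+x. indicator ?A (m' + x) \<partial>lborel)"
    by (rule nn_integral_lborel_translate[symmetric]) measurable
  also have "\<dots> = (\<integral>\<^sup>+x. indicator ?C x \<partial>lborel)"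
    using m' by (intro nn_integral_cong) (auto simp: indicator_def inner_left_distrib inner_diff_left)
  also have "\<dots> = (\<integral>\<^sup>+f. indicator ?C (\<Sum>k\<in>Basis. f k *\<^sub>R k) \<partial>(Pi\<^sub>M (insert b ?I) (\<lambda>_. lborel)))"
    unfolding ins by (subst lborel_eq, subst nn_integral_distr) auto
  also have "\<dots> = (\<integral>\<^sup>+f. \<integral>\<^sup>+y. indicator ?C (\<Sum>k\<in>Basis. (f(b := y)) k *\<^sub>R k) \<partial>lborel \<partial>(Pi\<^sub>M ?I (\<lambda>_. lborel)))"
    by (rule product_nn_integral_insert) (auto simp: ins)
  also have "\<dots> = (\<integral>\<^sup>+f. \<integral>\<^sup>+y. indicator ?B f * indicator {0..1::real} y \<partial>lborel \<partial>(Pi\<^sub>M ?I (\<lambda>_. lborel)))"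
    by (intro nn_integral_cong pt)
  also have "\<dots> = (\<integral>\<^sup>+f. indicator ?B f \<partial>(Pi\<^sub>M ?I (\<lambda>_. lborel)))"
    by (intro nn_integral_cong) (simp add: nn_integral_cmult)
  also have "\<dots> = emeasure (Pi\<^sub>M ?I (\<lambda>_. lborel)) ?B"
    by simp
  also have "\<dots> = ennreal (unit_ball_vol (real (card ?I)) * r ^ card ?I)"
    by (rule emeasure_cball_aux) (use r in auto)
  finally show ?thesis using b by (simp add: card_Diff_singleton)
qed

text \<open>
  Both sets lie between their infima and suprema, and \<open>Sup X - Inf Y\<close> and \<open>Sup Y - Inf X\<close> are at
  most \<open>e\<close>. This is the one-dimensional reason why symmetrisation does not increase the diameter.
\<close>

lemma emeasure_lborel_add_le_of_dist_le:
  fixes X Y :: "real set"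
  assumes "X \<noteq> {}" "Y \<noteq> {}" and d: "\<And>s t. s \<in> X \<Longrightarrow> t \<in> Y \<Longrightarrow> \<bar>s - t\<bar> \<le> e"
    and "X \<in> sets borel" "Y \<in> sets borel"
  shows "emeasure lborel X + emeasure lborel Y \<le> ennreal (2 * e)"
proof -
  obtain s0 t0 where s0: "s0 \<in> X" and t0: "t0 \<in> Y" using assms by blast
  have X: "bdd_above X" "bdd_below X" using d[OF _ t0] by (force intro: bdd_aboveI[of _ "t0+e"] bdd_belowI[of _ "t0-e"])+
  have Y: "bdd_above Y" "bdd_below Y" using d[OF s0] by (force intro: bdd_aboveI[of _ "s0+e"] bdd_belowI[of _ "s0-e"])+
  have "X \<subseteq> {Inf X..Sup X}" "Y \<subseteq> {Inf Y..Sup Y}" using X Y by (auto intro: cInf_lower cSup_upper)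
  then have le: "emeasure lborel X \<le> emeasure lborel {Inf X..Sup X}" "emeasure lborel Y \<le> emeasure lborel {Inf Y..Sup Y}"
    by (intro emeasure_mono; simp)+
  have i: "Inf X \<le> Sup X" "Inf Y \<le> Sup Y" using X Y assms by (simp_all add: cInf_le_cSup)
  have "Sup X \<le> e + Inf Y"
  proof (rule cSup_least[OF assms(1)])
    fix s assume "s \<in> X"
    then have "s - e \<le> Inf Y" using d by (intro cInf_greatest assms) force
    then show "s \<le> e + Inf Y" by simp
  qed
  moreover have "Sup Y \<le> e + Inf X"
  proof (rule cSup_least[OF assms(2)])
    fix s assume "s \<in> Y"
    then have "s - e \<le> Inf X" using d by (intro cInf_greatest assms) force
    then show "s \<le> e + Inf X" by simp
  qed
  ultimately have "emeasure lborel {Inf X..Sup X} + emeasure lborel {Inf Y..Sup Y} \<le> ennreal (2 * e)"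
    using i by (simp add: ennreal_plus[symmetric] del: ennreal_plus)
  then show ?thesis using le add_mono order_trans by blast
qed

text \<open>
  Steiner symmetrisation: every section in direction \<open>b\<close> is replaced by the centred open interval of
  the same length. The strict inequality makes empty sections stay empty.
\<close>

definition steiner :: "'a::euclidean_space \<Rightarrow> 'a set \<Rightarrow> 'a set" where
  "steiner b A = {x. ennreal (2 * \<bar>x \<bullet> b\<bar>) < emeasure lborel {s. coord_upd b s x \<in> A}}"

lemma sets_section [measurable]:
  assumes [measurable]: "A \<in> sets borel"
  shows "{s. coord_upd b s x \<in> A} \<in> sets borel"
  by measurable

lemma emeasure_section:
  assumes "A \<in> sets borel"
  shows "emeasure lborel {s. coord_upd b s x \<in> A} = (\<integral>\<^sup>+s. indicator A (coord_upd b s x) \<partial>lborel)"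
proof -
  have "(\<integral>\<^sup>+s. indicator A (coord_upd b s x) \<partial>lborel) = (\<integral>\<^sup>+s. indicator {s. coord_upd b s x \<in> A} s \<partial>lborel)"
    by (intro nn_integral_cong) (auto simp: indicator_def)
  then show ?thesis using sets_section[OF assms] by simp
qed

lemma sets_steiner [measurable]:
  assumes [measurable]: "A \<in> sets borel"
  shows "steiner b A \<in> sets borel"
  unfolding steiner_def emeasure_section[OF assms] by measurable

lemma emeasure_steiner:
  assumes b: "b \<in> Basis" and [measurable]: "A \<in> sets borel"
  shows "emeasure lborel (steiner b A) = emeasure lborel A"
proof -
  have "emeasure lborel {s. coord_upd b s x \<in> steiner b A} = emeasure lborel {s. coord_upd b s x \<in> A}" for x
  proof (cases "emeasure lborel {s. coord_upd b s x \<in> A}")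
    case (real r)
    have "{s. coord_upd b s x \<in> steiner b A} = {-(r/2)<..<r/2}"
      using real b by (auto simp: steiner_def inner_coord_upd ennreal_less_iff)
    then show ?thesis using real by simp
  next
    case top
    have "{s. coord_upd b s x \<in> steiner b A} = UNIV"
      using top b by (auto simp: steiner_def inner_coord_upd)
    then show ?thesis using top by (simp add: emeasure_lborel_UNIV)
  qed
  then have "(\<integral>\<^sup>+s. indicator (steiner b A) (coord_upd b s x) \<partial>lborel) = (\<integral>\<^sup>+s. indicator A (coord_upd b s x) \<partial>lborel)" for x
    by (simp add: emeasure_section)
  then have "(\<integral>\<^sup>+x. indicator (steiner b A) x \<partial>lborel) = (\<integral>\<^sup>+x. indicator A x \<partial>lborel)"
    by (subst (1 2) nn_integral_lborel_slice[OF b]) auto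
  then show ?thesis by simp
qed

lemma steiner_section_nonempty: "x \<in> steiner b A \<Longrightarrow> \<exists>s. coord_upd b s x \<in> A"
  by (rule ccontr) (auto simp: steiner_def)

text \<open>
  Two points of the symmetrised set with the sections \<open>X\<close> and \<open>Y\<close> above them satisfy
  \<open>|x \<bullet> b - y \<bullet> b| \<le> (|X| + |Y|) / 2 \<le> e\<close>, where \<open>e\<close> bounds the distances between \<open>X\<close> and \<open>Y\<close>. The
  statement concerns a partial set of coordinates because \<open>A\<close> will be a cylinder, whose extent in the
  direction of its axis is to be ignored.
\<close>

lemma steiner_diameter:
  assumes b: "b \<in> J" "J \<subseteq> Basis" and [measurable]: "A \<in> sets borel"
    and D: "\<And>x y. x \<in> A \<Longrightarrow> y \<in> A \<Longrightarrow> (\<Sum>k\<in>J. ((x - y) \<bullet> k)\<^sup>2) \<le> D\<^sup>2"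
    and xy: "x \<in> steiner b A" "y \<in> steiner b A"
  shows "(\<Sum>k\<in>J. ((x - y) \<bullet> k)\<^sup>2) \<le> D\<^sup>2"
proof -
  have bB: "b \<in> Basis" using b by auto
  have fin: "finite J" using b(2) finite_Basis by (rule finite_subset)
  define q where "q = (\<Sum>k\<in>J-{b}. ((x - y) \<bullet> k)\<^sup>2)"
  let ?X = "{s. coord_upd b s x \<in> A}" and ?Y = "{s. coord_upd b s y \<in> A}"
  have ne: "?X \<noteq> {}" "?Y \<noteq> {}" using steiner_section_nonempty xy by auto
  have st: "(s - t)\<^sup>2 + q \<le> D\<^sup>2" if "s \<in> ?X" "t \<in> ?Y" for s t
  proof -
    have "(\<Sum>k\<in>J. ((coord_upd b s x - coord_upd b t y) \<bullet> k)\<^sup>2)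
        = (s - t)\<^sup>2 + (\<Sum>k\<in>J-{b}. ((coord_upd b s x - coord_upd b t y) \<bullet> k)\<^sup>2)"
      using fin b bB by (subst sum.remove[of _ b]) (auto simp: inner_diff_left inner_coord_upd)
    also have "(\<Sum>k\<in>J-{b}. ((coord_upd b s x - coord_upd b t y) \<bullet> k)\<^sup>2) = q"
      unfolding q_def using b bB by (intro sum.cong) (auto simp: inner_diff_left inner_coord_upd)
    finally show ?thesis using D[of "coord_upd b s x" "coord_upd b t y"] that by auto
  qed
  have qD: "q \<le> D\<^sup>2" using st ne by (smt (verit) mem_Collect_eq ex_in_conv zero_le_power2)
  define e where "e = sqrt (D\<^sup>2 - q)"
  have "\<bar>s - t\<bar> \<le> e" if "s \<in> ?X" "t \<in> ?Y" for s t
    unfolding e_def using st[OF that] by (intro real_le_rsqrt) (simp add: power2_abs)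
  then have "emeasure lborel ?X + emeasure lborel ?Y \<le> ennreal (2 * e)"
    using ne by (intro emeasure_lborel_add_le_of_dist_le) auto
  moreover have "ennreal (2 * \<bar>x \<bullet> b\<bar>) + ennreal (2 * \<bar>y \<bullet> b\<bar>) \<le> emeasure lborel ?X + emeasure lborel ?Y"
    using xy by (intro add_mono) (auto simp: steiner_def)
  ultimately have "ennreal (2 * \<bar>x \<bullet> b\<bar> + 2 * \<bar>y \<bullet> b\<bar>) \<le> ennreal (2 * e)"
    by (subst ennreal_plus) auto
  moreover have "0 \<le> e" using qD by (simp add: e_def)
  ultimately have "2 * \<bar>x \<bullet> b\<bar> + 2 * \<bar>y \<bullet> b\<bar> \<le> 2 * e" by (subst (asm) ennreal_le_iff) auto
  then have "\<bar>(x - y) \<bullet> b\<bar> \<le> e" by (simp add: inner_diff_left)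
  then have "((x - y) \<bullet> b)\<^sup>2 \<le> e\<^sup>2" by (metis abs_ge_zero power2_abs power_mono)
  also have "e\<^sup>2 = D\<^sup>2 - q" using qD by (simp add: e_def)
  finally show ?thesis
    using fin b by (subst sum.remove[of _ b]) (auto simp: q_def)
qed

definition flip :: "'a::euclidean_space \<Rightarrow> 'a \<Rightarrow> 'a" where
  "flip b x = coord_upd b (- (x \<bullet> b)) x"

lemma inner_flip: "b \<in> Basis \<Longrightarrow> k \<in> Basis \<Longrightarrow> flip b x \<bullet> k = (if k = b then - (x \<bullet> k) else x \<bullet> k)"
  by (simp add: flip_def inner_coord_upd)

lemma flip_flip [simp]: "b \<in> Basis \<Longrightarrow> flip b (flip b x) = x"
  by (rule euclidean_eqI) (simp add: inner_flip)

lemma steiner_flip_same: "b \<in> Basis \<Longrightarrow> x \<in> steiner b A \<Longrightarrow> flip b x \<in> steiner b A"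
  by (simp add: steiner_def flip_def inner_coord_upd)

lemma steiner_flip_other:
  assumes "b \<in> Basis" "k \<in> Basis" "k \<noteq> b" and A: "\<And>x. x \<in> A \<Longrightarrow> flip k x \<in> A" and x: "x \<in> steiner b A"
  shows "flip k x \<in> steiner b A"
proof -
  have eq: "coord_upd b s (flip k x) = flip k (coord_upd b s x)" for s
    by (rule euclidean_eqI) (use assms(1-3) in \<open>simp add: inner_coord_upd inner_flip\<close>)
  have "flip k z \<in> A \<longleftrightarrow> z \<in> A" for z
    using A assms(2) flip_flip by metis
  then show ?thesis
    using x assms by (simp add: steiner_def eq inner_flip)
qed

text \<open>
  Symmetrising in a further direction keeps the symmetries already obtained.
\<close>

lemma iterated_steiner:
  fixes A :: "'a::euclidean_space set"
  assumes "b \<in> Basis" "A \<in> sets borel" "A \<subseteq> {x. x \<bullet> b \<in> {0..1}}"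
    and D: "\<And>x y. x \<in> A \<Longrightarrow> y \<in> A \<Longrightarrow> (\<Sum>k\<in>Basis-{b}. ((x - y) \<bullet> k)\<^sup>2) \<le> D\<^sup>2"
    and "finite J" "J \<subseteq> Basis - {b}"
  shows "\<exists>A'\<in>sets borel. emeasure lborel A' = emeasure lborel A \<and> A' \<subseteq> {x. x \<bullet> b \<in> {0..1}}
    \<and> (\<forall>x\<in>A'. \<forall>y\<in>A'. (\<Sum>k\<in>Basis-{b}. ((x - y) \<bullet> k)\<^sup>2) \<le> D\<^sup>2) \<and> (\<forall>k\<in>J. \<forall>x\<in>A'. flip k x \<in> A')"
  using assms(5,6)
proof induction
  case empty
  then show ?case using assms by blast
next
  case (insert j J)
  then obtain A' where A': "A' \<in> sets borel" "emeasure lborel A' = emeasure lborel A" "A' \<subseteq> {x. x \<bullet> b \<in> {0..1}}"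
    "\<forall>x\<in>A'. \<forall>y\<in>A'. (\<Sum>k\<in>Basis-{b}. ((x - y) \<bullet> k)\<^sup>2) \<le> D\<^sup>2" "\<forall>k\<in>J. \<forall>x\<in>A'. flip k x \<in> A'"
    by auto
  have j: "j \<in> Basis" "j \<noteq> b" "j \<in> Basis - {b}" using insert by auto
  show ?case
  proof (intro bexI[of _ "steiner j A'"] conjI ballI)
    show "emeasure lborel (steiner j A') = emeasure lborel A" using A' j by (simp add: emeasure_steiner)
    show "steiner j A' \<subseteq> {x. x \<bullet> b \<in> {0..1}}"
    proof
      fix x assume "x \<in> steiner j A'"
      then obtain s where "coord_upd j s x \<in> A'" using steiner_section_nonempty by blast
      then have "coord_upd j s x \<bullet> b \<in> {0..1}" using A'(3) by blast
      then show "x \<in> {x. x \<bullet> b \<in> {0..1}}" using j \<open>b \<in> Basis\<close> by (simp add: inner_coord_upd)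
    qed
    show "(\<Sum>k\<in>Basis-{b}. ((x - y) \<bullet> k)\<^sup>2) \<le> D\<^sup>2" if "x \<in> steiner j A'" "y \<in> steiner j A'" for x y
      by (rule steiner_diameter[OF j(3) Diff_subset A'(1) _ that]) (use A'(4) in blast)
    show "flip k x \<in> steiner j A'" if "k \<in> insert j J" "x \<in> steiner j A'" for k x
    proof (cases "k = j")
      case False
      then show ?thesis using that insert.prems A'(5) j by (intro steiner_flip_other) auto
    qed (use that j steiner_flip_same in auto)
    show "steiner j A' \<in> sets borel" using A'(1) by simp
  qed
qed

text \<open>
  A set that is symmetric in every coordinate other than \<open>b\<close> contains with \<open>x\<close> the point \<open>y\<close> whose
  coordinates other than that in direction \<open>b\<close> have the opposite signs. As \<open>x - y\<close> is twice the projection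
  of \<open>x\<close>, the projection of the set lies in a ball of radius half the diameter. Approaching \<open>D\<close> from above
  includes the degenerate case of diameter 0.
\<close>

lemma isodiametric_cylinder:
  fixes A :: "'a::euclidean_space set"
  assumes b: "b \<in> Basis" and A: "A \<in> sets borel" "A \<subseteq> {x. x \<bullet> b \<in> {0..1}}" and D0: "0 \<le> D"
    and D: "\<And>x y. x \<in> A \<Longrightarrow> y \<in> A \<Longrightarrow> (\<Sum>k\<in>Basis-{b}. ((x - y) \<bullet> k)\<^sup>2) \<le> D\<^sup>2"
  shows "emeasure lborel A \<le> ennreal (unit_ball_vol (real (DIM('a) - 1)) * (D / 2) ^ (DIM('a) - 1))"
proof -
  let ?f = "\<lambda>E. unit_ball_vol (real (DIM('a) - 1)) * (E / 2) ^ (DIM('a) - 1)"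
  have le: "emeasure lborel A \<le> ennreal (?f E)" if "D < E" for E
  proof -
    have E: "(\<Sum>k\<in>Basis-{b}. ((x - y) \<bullet> k)\<^sup>2) \<le> E\<^sup>2" if "x \<in> A" "y \<in> A" for x y
      using order_trans[OF D[OF that] power_mono[of D E 2]] \<open>D < E\<close> D0 by simp
    obtain A' where A': "A' \<in> sets borel" "emeasure lborel A' = emeasure lborel A" "A' \<subseteq> {x. x \<bullet> b \<in> {0..1}}"
      "\<forall>x\<in>A'. \<forall>y\<in>A'. (\<Sum>k\<in>Basis-{b}. ((x - y) \<bullet> k)\<^sup>2) \<le> E\<^sup>2" "\<forall>k\<in>Basis-{b}. \<forall>x\<in>A'. flip k x \<in> A'"
      using iterated_steiner[OF b A E, of "Basis - {b}"] by auto
    have "A' \<subseteq> {x. x \<bullet> b \<in> {0..1} \<and> (\<Sum>k\<in>Basis-{b}. ((x - 0) \<bullet> k)\<^sup>2) \<le> (E/2)\<^sup>2}"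
    proof
      fix x assume x: "x \<in> A'"
      \<comment> \<open>The sign changes are carried out one coordinate at a time.\<close>
      have "\<exists>y\<in>A'. \<forall>k\<in>Basis. y \<bullet> k = (if k \<in> J then - (x \<bullet> k) else x \<bullet> k)" if "finite J" "J \<subseteq> Basis - {b}" for J
        using that
      proof induction
        case (insert j J)
        then obtain y where "y \<in> A'" "\<forall>k\<in>Basis. y \<bullet> k = (if k \<in> J then - (x \<bullet> k) else x \<bullet> k)" by auto
        then show ?case using insert A'(5) by (intro bexI[of _ "flip j y"]) (auto simp: inner_flip)
      qed (use x in auto)
      then obtain y where y: "y \<in> A'" "\<forall>k\<in>Basis. y \<bullet> k = (if k \<in> Basis - {b} then - (x \<bullet> k) else x \<bullet> k)"
        by (meson finite_Basis finite_Diff order_refl)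
      have "(\<Sum>k\<in>Basis-{b}. ((x - y) \<bullet> k)\<^sup>2) = (\<Sum>k\<in>Basis-{b}. 4 * (x \<bullet> k)\<^sup>2)"
        using y(2) by (intro sum.cong) (auto simp: inner_diff_left power2_eq_square)
      then have "4 * (\<Sum>k\<in>Basis-{b}. (x \<bullet> k)\<^sup>2) \<le> E\<^sup>2"
        using A'(4) x y(1) by (metis sum_distrib_left)
      then show "x \<in> {x. x \<bullet> b \<in> {0..1} \<and> (\<Sum>k\<in>Basis-{b}. ((x - 0) \<bullet> k)\<^sup>2) \<le> (E/2)\<^sup>2}"
        using A'(3) x by (auto simp: power_divide)
    qed
    then have "emeasure lborel A' \<le> emeasure lborel {x. x \<bullet> b \<in> {0..1} \<and> (\<Sum>k\<in>Basis-{b}. ((x - 0) \<bullet> k)\<^sup>2) \<le> (E/2)\<^sup>2}"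
      by (rule emeasure_mono) measurable
    also have "\<dots> = ennreal (?f E)" using that D0 by (intro emeasure_lborel_cylinder_ball b) auto
    finally show ?thesis using A'(2) by simp
  qed
  have "((\<lambda>E. ennreal (?f E)) \<longlongrightarrow> ennreal (?f D)) (at_right D)"
    by (intro tendsto_ennrealI tendsto_intros) auto
  then show ?thesis
    by (rule tendsto_lowerbound[OF _ eventually_mono[OF eventually_at_right_less le]]) simp_all
qed

section \<open>Hausdorff measure on a coordinate hyperplane\<close>

text \<open>
  Lebesgue measure on the hyperplane \<open>x \<bullet> b = c\<close>, as the image of Lebesgue measure on a slab of height 1.
\<close>

definition flat_measure :: "'a::euclidean_space \<Rightarrow> real \<Rightarrow> 'a measure" where
  "flat_measure b c = distr (density lborel (\<lambda>x. indicator {0..1} (x \<bullet> b))) borel (coord_upd b c)"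

lemma sets_flat_measure [simp, measurable_cong]: "sets (flat_measure b c) = sets borel"
  by (simp add: flat_measure_def)

lemma nn_integral_flat_measure:
  assumes [measurable]: "f \<in> borel_measurable borel"
  shows "(\<integral>\<^sup>+x. f x \<partial>flat_measure b c) = (\<integral>\<^sup>+x. indicator {0..1} (x \<bullet> b) * f (coord_upd b c x) \<partial>lborel)"
  unfolding flat_measure_def by (simp add: nn_integral_distr nn_integral_density)

lemma emeasure_flat_measure:
  assumes [measurable]: "A \<in> sets borel"
  shows "emeasure (flat_measure b c) A = emeasure lborel {x. x \<bullet> b \<in> {0..1} \<and> coord_upd b c x \<in> A}"
proof -
  have "emeasure (flat_measure b c) A = (\<integral>\<^sup>+x. indicator A x \<partial>flat_measure b c)"
    by simp
  also have "\<dots> = (\<integral>\<^sup>+x. indicator {x. x \<bullet> b \<in> {0..1} \<and> coord_upd b c x \<in> A} x \<partial>lborel)"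
    by (subst nn_integral_flat_measure, measurable) (rule nn_integral_cong, simp add: indicator_def)
  also have "\<dots> = emeasure lborel {x. x \<bullet> b \<in> {0..1} \<and> coord_upd b c x \<in> A}"
    by (rule nn_integral_indicator) measurable
  finally show ?thesis .
qed

lemma norm_power2_split:
  fixes x b :: "'a::euclidean_space"
  assumes "b \<in> Basis"
  shows "(norm x)\<^sup>2 = (x \<bullet> b)\<^sup>2 + (\<Sum>k\<in>Basis-{b}. (x \<bullet> k)\<^sup>2)"
proof -
  have "(norm x)\<^sup>2 = (\<Sum>k\<in>Basis. (x \<bullet> k)\<^sup>2)"
    unfolding power2_norm_eq_inner by (subst euclidean_inner) (simp add: power2_eq_square)
  then show ?thesis using assms by (simp add: sum.remove)
qed

lemma flat_measure_le_charge:
  fixes C :: "'a::euclidean_space set"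
  assumes b: "b \<in> Basis" and "closed C" "bounded C"
  shows "emeasure (flat_measure b c) C \<le> hausdorff_charge (DIM('a) - 1) C"
proof (cases "C = {}")
  case False
  have [measurable]: "C \<in> sets borel" using \<open>closed C\<close> by simp
  let ?A = "{x. x \<bullet> b \<in> {0..1} \<and> coord_upd b c x \<in> C}"
  have "emeasure lborel ?A \<le> ennreal (unit_ball_vol (real (DIM('a) - 1)) * (diameter C / 2) ^ (DIM('a) - 1))"
  proof (rule isodiametric_cylinder[OF b])
    show "?A \<in> sets borel" by measurable
    show "0 \<le> diameter C" using \<open>bounded C\<close> by (rule diameter_ge_0)
    fix x y assume xy: "x \<in> ?A" "y \<in> ?A"
    let ?z = "coord_upd b c x - coord_upd b c y"
    have "(\<Sum>k\<in>Basis-{b}. ((x - y) \<bullet> k)\<^sup>2) = (\<Sum>k\<in>Basis-{b}. (?z \<bullet> k)\<^sup>2)"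
      using b by (intro sum.cong) (auto simp: inner_diff_left inner_coord_upd)
    also have "\<dots> \<le> (norm ?z)\<^sup>2" by (simp add: norm_power2_split[OF b])
    also have "\<dots> \<le> (diameter C)\<^sup>2"
      using diameter_bounded_bound[OF \<open>bounded C\<close>, of "coord_upd b c x" "coord_upd b c y"] xy
      by (intro power_mono) (auto simp: dist_norm)
    finally show "(\<Sum>k\<in>Basis-{b}. ((x - y) \<bullet> k)\<^sup>2) \<le> (diameter C)\<^sup>2" .
  qed auto
  then show ?thesis using False by (simp add: hausdorff_charge_def emeasure_flat_measure)
qed simp

text \<open>
  The isodiametric inequality bounds the Lebesgue measure of every covering set by its charge. It is
  applied to the closures of the covering sets, which are measurable and have the same diameters.
\<close>

lemma flat_measure_le_hausdorff:
  fixes A :: "'a::euclidean_space set"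
  assumes b: "b \<in> Basis" and A: "A \<in> sets borel"
  shows "emeasure (flat_measure b c) A \<le> emeasure (hausdorff_measure (DIM('a) - 1)) A"
proof -
  let ?d = "DIM('a) - 1"
  have "emeasure (flat_measure b c) A \<le> hausdorff_content ?d 1 A"
    unfolding hausdorff_content_def
  proof (rule INF_greatest)
    fix C :: "nat \<Rightarrow> 'a set"
    assume "C \<in> {C. A \<subseteq> (\<Union>i. C i) \<and> (\<forall>i. bounded (C i) \<and> diameter (C i) \<le> 1)}"
    then have C: "A \<subseteq> (\<Union>i. C i)" "\<And>i. bounded (C i)" by auto
    have "emeasure (flat_measure b c) A \<le> emeasure (flat_measure b c) (\<Union>i. closure (C i))"
      using C(1) closure_subset by (intro emeasure_mono) (blast, auto)
    also have "\<dots> \<le> (\<Sum>i. emeasure (flat_measure b c) (closure (C i)))"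
      by (rule emeasure_subadditive_countably) auto
    also have "\<dots> \<le> (\<Sum>i. hausdorff_charge ?d (closure (C i)))"
      using C(2) by (intro suminf_le flat_measure_le_charge b) auto
    also have "\<dots> = (\<Sum>i. hausdorff_charge ?d (C i))"
      using C(2) by (intro suminf_cong) (simp add: hausdorff_charge_def diameter_closure)
    finally show "emeasure (flat_measure b c) A \<le> (\<Sum>i. hausdorff_charge ?d (C i))" .
  qed
  also have "\<dots> \<le> hausdorff_outer_measure ?d A" by (rule hausdorff_content_le_outer) simp
  finally show ?thesis using A by (simp add: emeasure_hausdorff_measure)
qed

definition flat_unit_cube :: "'a::euclidean_space \<Rightarrow> 'a set" where
  "flat_unit_cube b = {x. x \<bullet> b = 0 \<and> (\<forall>k\<in>Basis-{b}. x \<bullet> k \<in> {0..1})}"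

text \<open>
  The index \<open>N - 1\<close> instead of \<open>N\<close> is used for coordinates equal to 1, to keep the cells inside the cube.
\<close>

lemma flat_unit_cube_tiling:
  fixes b :: "'a::euclidean_space"
  assumes b: "b \<in> Basis" and N: "0 < (N::nat)"
  shows "flat_unit_cube b \<subseteq> (\<Union>z\<in>PiE (Basis-{b}) (\<lambda>_. {..<N}).
     (\<lambda>x. (\<Sum>k\<in>Basis-{b}. (real (z k) / real N) *\<^sub>R k) + (1 / real N) *\<^sub>R x) ` flat_unit_cube b)"
proof
  fix x :: 'a assume x: "x \<in> flat_unit_cube b"
  define z where "z = (\<lambda>k\<in>Basis-{b}. min (nat \<lfloor>real N * (x \<bullet> k)\<rfloor>) (N - 1))"
  define v where "v = (\<Sum>k\<in>Basis-{b}. (real (z k) / real N) *\<^sub>R k)"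
  have vk: "v \<bullet> k = (if k = b then 0 else real (z k) / real N)" if "k \<in> Basis" for k
  proof -
    have "v \<bullet> k = (\<Sum>j\<in>Basis-{b}. if j = k then real (z j) / real N else 0)"
      unfolding v_def inner_sum_left using that by (intro sum.cong) (auto simp: inner_Basis)
    then show ?thesis using that by simp
  qed
  have "z \<in> PiE (Basis-{b}) (\<lambda>_. {..<N})" using N by (auto simp: z_def)
  moreover have "real N *\<^sub>R (x - v) \<in> flat_unit_cube b"
  proof -
    have "real N * (x \<bullet> k - real (z k) / real N) \<in> {0..1}" if k: "k \<in> Basis - {b}" for k
    proof -
      define t where "t = real N * (x \<bullet> k)"
      have t: "0 \<le> t" "t \<le> real N" using x k by (auto simp: t_def flat_unit_cube_def intro!: mult_left_le)
      have zk: "real (z k) = min (real_of_int \<lfloor>t\<rfloor>) (real N - 1)"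
        using k N t by (auto simp: z_def t_def[symmetric] min_def of_nat_diff le_floor_iff; linarith)
      have "t - real (z k) \<in> {0..1}" unfolding zk using t by (auto simp: min_def; linarith)
      then show ?thesis using N by (simp add: t_def right_diff_distrib)
    qed
    then show ?thesis using x b by (auto simp: flat_unit_cube_def inner_diff_left vk)
  qed
  moreover have "x = v + (1 / real N) *\<^sub>R (real N *\<^sub>R (x - v))" using N by simp
  ultimately show "x \<in> (\<Union>z\<in>PiE (Basis-{b}) (\<lambda>_. {..<N}).
     (\<lambda>x. (\<Sum>k\<in>Basis-{b}. (real (z k) / real N) *\<^sub>R k) + (1 / real N) *\<^sub>R x) ` flat_unit_cube b)"
    unfolding v_def by blast
qed

text \<open>
  A covering of the cube by \<open>E\<close> and \<open>R\<close> is copied into each of the \<open>N ^ d\<close> cells, scaled by \<open>1 / N\<close>. In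
  each cell the scaled copy of \<open>E\<close> serves as a covering set of small diameter. The scaling factors
  of the charge and of the measure cancel the number of cells, so \<open>E\<close> contributes its charge
  however fine the coverings have to be.
\<close>

lemma hausdorff_flat_unit_cube_le:
  fixes b :: "'a::euclidean_space" and E R :: "'a set"
  assumes b: "b \<in> Basis" and E: "bounded E" and cover: "flat_unit_cube b \<subseteq> E \<union> R"
  shows "hausdorff_outer_measure (DIM('a) - 1) (flat_unit_cube b)
    \<le> hausdorff_charge (DIM('a) - 1) E + hausdorff_outer_measure (DIM('a) - 1) R"
  unfolding hausdorff_outer_measure_def[of _ "flat_unit_cube b"]
proof (rule SUP_least)
  let ?d = "DIM('a) - 1"
  let ?H = "hausdorff_outer_measure ?d"
  fix \<delta> :: real assume "\<delta> \<in> {0<..}"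
  then have \<delta>: "0 < \<delta>" by simp
  obtain N :: nat where N0: "diameter E / \<delta> < real N" using reals_Archimedean2 by blast
  have N: "0 < N" using N0 diameter_ge_0[OF E] \<delta> by (metis divide_nonneg_pos gr0I not_less of_nat_0)
  let ?Z = "PiE (Basis-{b}) (\<lambda>_. {..<N}) :: ('a \<Rightarrow> nat) set"
  define T where "T = (\<lambda>z x. (\<Sum>k\<in>Basis-{b}. (real (z k) / real N) *\<^sub>R k) + (1 / real N) *\<^sub>R x :: 'a)"
  have lip: "dist (T z x) (T z y) \<le> (1 / real N) * dist x y" for z x y
    by (simp add: T_def dist_norm flip: scaleR_right_diff_distrib)
  have Np: "0 < 1 / real N" using N by simp
  have finZ: "finite ?Z" by (intro finite_PiE) auto
  have cardZ: "card ?Z = N ^ ?d" using b by (simp add: card_PiE card_Diff_singleton)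
  let ?q = "ennreal ((1 / real N) ^ ?d)"
  have one: "hausdorff_content ?d \<delta> (T z ` E \<union> T z ` R) \<le> ?q * (hausdorff_charge ?d E + ?H R)" for z
  proof -
    have "hausdorff_content ?d \<delta> (T z ` E \<union> T z ` R)
        \<le> hausdorff_content ?d \<delta> (T z ` E) + hausdorff_content ?d \<delta> (T z ` R)"
      using \<delta> by (intro hausdorff_content_Un) auto
    also have "\<dots> \<le> hausdorff_charge ?d (T z ` E) + ?H (T z ` R)"
    proof (intro add_mono hausdorff_content_le_outer hausdorff_content_le_charge \<delta>)
      show "bounded (T z ` E)" by (rule lipschitz_image_diameter[OF Np lip E])
      have "diameter (T z ` E) \<le> 1 / real N * diameter E" by (rule lipschitz_image_diameter[OF Np lip E])
      also have "\<dots> \<le> \<delta>" using N0 N \<delta> by (simp add: field_simps)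
      finally show "diameter (T z ` E) \<le> \<delta>" .
    qed (use \<delta> in auto)
    also have "\<dots> \<le> ?q * hausdorff_charge ?d E + ?q * ?H R"
      by (intro add_mono hausdorff_charge_lipschitz_image hausdorff_outer_measure_lipschitz_image Np lip E)
    finally show ?thesis by (simp add: distrib_left)
  qed
  have "flat_unit_cube b \<subseteq> (\<Union>z\<in>?Z. T z ` E \<union> T z ` R)"
  proof
    fix x assume "x \<in> flat_unit_cube b"
    then obtain z y where z: "z \<in> ?Z" and y: "y \<in> flat_unit_cube b" "x = T z y"
      using flat_unit_cube_tiling[OF b N] unfolding T_def by blast
    then have "y \<in> E \<union> R" using cover by blast
    then show "x \<in> (\<Union>z\<in>?Z. T z ` E \<union> T z ` R)" using z y(2) by blast
  qed
  then have "hausdorff_content ?d \<delta> (flat_unit_cube b) \<le> hausdorff_content ?d \<delta> (\<Union>z\<in>?Z. T z ` E \<union> T z ` R)"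
    by (rule hausdorff_content_mono)
  also have "\<dots> \<le> (\<Sum>z\<in>?Z. hausdorff_content ?d \<delta> (T z ` E \<union> T z ` R))"
    using finZ \<delta> by (intro hausdorff_content_UN) auto
  also have "\<dots> \<le> (\<Sum>z\<in>?Z. ?q * (hausdorff_charge ?d E + ?H R))"
    by (intro sum_mono one)
  also have "\<dots> = (ennreal (real N ^ ?d) * ?q) * (hausdorff_charge ?d E + ?H R)"
    by (simp add: cardZ mult.assoc ennreal_power[symmetric] ennreal_of_nat_eq_real_of_nat)
  also have "ennreal (real N ^ ?d) * ?q = 1"
    using N by (simp add: ennreal_mult'[symmetric] power_one_over)
  finally show "hausdorff_content ?d \<delta> (flat_unit_cube b) \<le> hausdorff_charge ?d E + ?H R" by simp
qed

text \<open>
  With \<open>E\<close> the ball and \<open>R\<close> the rest of the cube, the preceding bound and additivity give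
  \<open>H(E) + H(R) \<le> charge E + H(R)\<close>. The measure of the cube is finite by the same bound with \<open>E\<close> the whole
  cube, so \<open>H(R)\<close> can be cancelled.
\<close>

lemma hausdorff_measure_inscribed_ball:
  fixes b :: "'a::euclidean_space"
  assumes b: "b \<in> Basis"
  defines "m \<equiv> (\<Sum>k\<in>Basis-{b}. (1/2) *\<^sub>R k)"
  shows "hausdorff_outer_measure (DIM('a) - 1) {x. x \<bullet> b = 0 \<and> norm (x - m) \<le> 1/2}
     \<le> ennreal (unit_ball_vol (real (DIM('a) - 1)) * (1/2) ^ (DIM('a) - 1))"
    (is "hausdorff_outer_measure _ ?B \<le> _")
proof -
  let ?d = "DIM('a) - 1"
  let ?H = "hausdorff_outer_measure ?d"
  let ?Q = "flat_unit_cube b"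
  have mk: "m \<bullet> k = 1/2" if "k \<in> Basis - {b}" for k
  proof -
    have "m \<bullet> k = (\<Sum>j\<in>Basis-{b}. if j = k then 1/2 else 0)"
      unfolding m_def inner_sum_left using that by (intro sum.cong) (auto simp: inner_Basis)
    then show ?thesis using that by simp
  qed
  have BQ: "?B \<subseteq> ?Q"
  proof
    fix x assume x: "x \<in> ?B"
    have "x \<bullet> k \<in> {0..1}" if "k \<in> Basis - {b}" for k
    proof -
      have "\<bar>x \<bullet> k - 1/2\<bar> \<le> 1/2"
        using Basis_le_norm[of k "x - m"] x that by (auto simp: inner_diff_left mk)
      then show ?thesis unfolding atLeastAtMost_iff by arith
    qed
    then show "x \<in> ?Q" using x by (simp add: flat_unit_cube_def)
  qed
  have "norm x \<le> real DIM('a)" if x: "x \<in> ?Q" for x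
  proof -
    have "norm x \<le> (\<Sum>k\<in>Basis. \<bar>x \<bullet> k\<bar>)" by (rule norm_le_l1)
    also have "\<dots> \<le> (\<Sum>k\<in>(Basis::'a set). 1)"
      using x b by (intro sum_mono) (force simp: flat_unit_cube_def)
    finally show ?thesis by simp
  qed
  then have bQ: "bounded ?Q" by (auto simp: bounded_iff)
  have bB: "bounded ?B" using bQ BQ by (rule bounded_subset)
  have "?H ?Q \<le> hausdorff_charge ?d ?Q + ?H ({} :: 'a set)"
    by (rule hausdorff_flat_unit_cube_le[OF b bQ]) auto
  also have "\<dots> < \<infinity>" by (simp add: hausdorff_outer_measure_empty hausdorff_charge_def)
  finally have finQ: "?H ?Q < \<infinity>" .
  have finR: "?H (?Q - ?B) < \<infinity>" using hausdorff_outer_measure_mono[of "?Q - ?B" ?Q ?d] finQ by (auto intro: le_less_trans)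
  have Qeq: "?Q = {x. x \<bullet> b = 0} \<inter> (\<Inter>k\<in>Basis-{b}. {x. 0 \<le> x \<bullet> k} \<inter> {x. x \<bullet> k \<le> 1})"
    by (auto simp: flat_unit_cube_def)
  have "closed ?Q"
    unfolding Qeq
    by (intro closed_Int closed_INT ballI closed_Collect_eq closed_Collect_le continuous_intros)
  then have Qm: "?Q \<in> sets borel" by simp
  have Bm: "?B \<in> sets borel" by measurable
  have "?H ?B + ?H (?Q - ?B) = ?H ?Q"
    using plus_emeasure[of ?B "hausdorff_measure ?d" "?Q - ?B"] Qm Bm BQ
    by (simp add: emeasure_hausdorff_measure Un_absorb1)
  also have "\<dots> \<le> hausdorff_charge ?d ?B + ?H (?Q - ?B)"
    by (rule hausdorff_flat_unit_cube_le[OF b bB]) auto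
  finally have "?H ?B \<le> hausdorff_charge ?d ?B"
    using finR by (auto simp: ennreal_add_left_cancel_le add.commute[of _ "?H (?Q - ?B)"] less_top)
  also have "\<dots> \<le> ennreal (unit_ball_vol (real ?d) * (1/2) ^ ?d)"
  proof -
    have "diameter ?B \<le> 1"
    proof (rule diameter_le)
      fix x y assume "x \<in> ?B" "y \<in> ?B"
      then show "norm (x - y) \<le> 1" using norm_triangle_ineq4[of "x - m" "y - m"] by simp
    qed auto
    then show ?thesis using diameter_ge_0[OF bB]
      by (auto simp: hausdorff_charge_def intro!: ennreal_leI mult_left_mono power_mono)
  qed
  finally show ?thesis .
qed

text \<open>
  Both measures agree on a ball \<open>B\<close> around \<open>A\<close>, by scaling of the inscribed ball. The lower bound
  for \<open>B - A\<close> then turns, by subtraction from \<open>B\<close>, into the upper bound for \<open>A\<close>.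
\<close>

theorem hausdorff_measure_eq_flat_measure:
  fixes A :: "'a::euclidean_space set"
  assumes b: "b \<in> Basis" and A: "A \<in> sets borel" "bounded A" "A \<subseteq> {x. x \<bullet> b = c}"
  shows "emeasure (hausdorff_measure (DIM('a) - 1)) A = emeasure (flat_measure b c) A"
proof (rule antisym)
  let ?d = "DIM('a) - 1"
  let ?H = "hausdorff_measure ?d :: 'a measure"
  let ?F = "flat_measure b c"
  have bb: "b \<bullet> b = 1" using b by simp
  obtain r0 where r0: "\<And>x. x \<in> A \<Longrightarrow> norm x \<le> r0" using A(2) by (auto simp: bounded_iff)
  \<comment> \<open>The ball is centred at \<open>c b\<close>, which has norm \<open>|c|\<close>.\<close>
  define r where "r = max r0 0 + \<bar>c\<bar> + 1"
  have r: "0 < r" by (auto simp: r_def)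
  define B where "B = {x. x \<bullet> b = c \<and> norm (x - c *\<^sub>R b) \<le> r}"
  have AB: "A \<subseteq> B"
  proof
    fix x assume "x \<in> A"
    then show "x \<in> B" using A(3) r0[of x] norm_triangle_ineq4[of x "c *\<^sub>R b"] b
      by (auto simp: B_def r_def norm_Basis)
  qed
  have Bm: "B \<in> sets borel" unfolding B_def by measurable
  have "emeasure ?H B \<le> ennreal (unit_ball_vol (real ?d) * r ^ ?d)"
  proof -
    define m where "m = (\<Sum>k\<in>Basis-{b}. (1/2) *\<^sub>R k)"
    let ?B1 = "{x. x \<bullet> b = 0 \<and> norm (x - m) \<le> 1/2}"
    have mb: "m \<bullet> b = 0" unfolding m_def inner_sum_left using b by (intro sum.neutral) (auto simp: inner_Basis)
    \<comment> \<open>The homothety that maps the ball of radius 1/2 inscribed in the unit cube to \<open>B\<close>.\<close>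
    define f where "f = (\<lambda>x. c *\<^sub>R b + (2 * r) *\<^sub>R (x - m))"
    have "B \<subseteq> f ` ?B1"
    proof
      fix x assume x: "x \<in> B"
      let ?y = "m + (1 / (2*r)) *\<^sub>R (x - c *\<^sub>R b)"
      have "x = f ?y" using r by (simp add: f_def)
      moreover have "norm (?y - m) = norm (x - c *\<^sub>R b) / (2 * r)" using r by simp
      then have "?y \<in> ?B1"
        using x r mb bb by (auto simp: B_def inner_left_distrib inner_diff_left simp del: add_diff_cancel_left' norm_scaleR)
      ultimately show "x \<in> f ` ?B1" by blast
    qed
    then have "hausdorff_outer_measure ?d B \<le> hausdorff_outer_measure ?d (f ` ?B1)"
      by (rule hausdorff_outer_measure_mono)
    also have "\<dots> \<le> ennreal ((2*r) ^ ?d) * hausdorff_outer_measure ?d ?B1"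
      using r by (intro hausdorff_outer_measure_lipschitz_image)
        (auto simp: f_def dist_norm simp flip: scaleR_right_diff_distrib)
    also have "\<dots> \<le> ennreal ((2*r) ^ ?d) * ennreal (unit_ball_vol (real ?d) * (1/2) ^ ?d)"
      unfolding m_def by (intro mult_left_mono hausdorff_measure_inscribed_ball b) auto
    also have "\<dots> = ennreal ((2*r) ^ ?d * (unit_ball_vol (real ?d) * (1/2) ^ ?d))"
      using r by (intro ennreal_mult[symmetric]) auto
    also have "(2*r) ^ ?d * (unit_ball_vol (real ?d) * (1/2) ^ ?d) = unit_ball_vol (real ?d) * (2*r*(1/2)) ^ ?d"
      by (simp only: power_mult_distrib mult_ac)
    finally show ?thesis by (simp add: emeasure_hausdorff_measure Bm)
  qed
  also have "\<dots> = emeasure lborel {x. x \<bullet> b \<in> {0..1} \<and> (\<Sum>k\<in>Basis-{b}. ((x - 0) \<bullet> k)\<^sup>2) \<le> r\<^sup>2}"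
    by (rule emeasure_lborel_cylinder_ball[symmetric, OF b r])
  also have "\<dots> = emeasure ?F B"
  proof -
    have "coord_upd b c x \<in> B \<longleftrightarrow> (\<Sum>k\<in>Basis-{b}. (x \<bullet> k)\<^sup>2) \<le> r\<^sup>2" for x
    proof -
      let ?z = "coord_upd b c x - c *\<^sub>R b"
      have "(\<Sum>k\<in>Basis-{b}. (?z \<bullet> k)\<^sup>2) = (\<Sum>k\<in>Basis-{b}. (x \<bullet> k)\<^sup>2)"
        using b by (intro sum.cong) (auto simp: inner_diff_left inner_coord_upd inner_Basis)
      moreover have "?z \<bullet> b = 0" using b by (simp add: inner_diff_left inner_coord_upd)
      ultimately have "(norm ?z)\<^sup>2 = (\<Sum>k\<in>Basis-{b}. (x \<bullet> k)\<^sup>2)" by (simp add: norm_power2_split[OF b])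
      moreover have "norm ?z \<le> r \<longleftrightarrow> (norm ?z)\<^sup>2 \<le> r\<^sup>2" using r by (simp add: power2_le_iff_abs_le)
      ultimately show ?thesis using b by (simp add: B_def inner_coord_upd)
    qed
    then show ?thesis using Bm by (simp add: emeasure_flat_measure)
  qed
  finally have HF: "emeasure ?H B \<le> emeasure ?F B" .
  have finB: "emeasure ?F B < \<infinity>"
    using \<open>_ = emeasure ?F B\<close>[symmetric] emeasure_lborel_cylinder_ball[OF b r, of 0] by simp
  have finR: "emeasure ?H (B - A) < \<infinity>"
    using emeasure_mono[of "B - A" B ?H] Bm HF finB by (auto intro: le_less_trans)
  have "emeasure ?H A + emeasure ?H (B - A) = emeasure ?H B"
    using plus_emeasure[of A ?H "B - A"] A(1) Bm AB by (simp add: Un_absorb1)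
  also have "\<dots> \<le> emeasure ?F B" by (rule HF)
  also have "\<dots> = emeasure ?F A + emeasure ?F (B - A)"
    using plus_emeasure[of A ?F "B - A"] A(1) Bm AB by (simp add: Un_absorb1)
  also have "\<dots> \<le> emeasure ?F A + emeasure ?H (B - A)"
    using A(1) Bm by (intro add_left_mono flat_measure_le_hausdorff b) auto
  finally show "emeasure ?H A \<le> emeasure ?F A"
    using finR by (auto simp: ennreal_add_left_cancel_le add.commute[of _ "emeasure ?H (B - A)"] less_top)
  show "emeasure ?F A \<le> emeasure ?H A"
    by (rule flat_measure_le_hausdorff[OF b A(1)])
qed

lemma nn_integral_hausdorff_measure_flat:
  fixes A :: "'a::euclidean_space set"
  assumes b: "b \<in> Basis" and A [measurable]: "A \<in> sets borel" and "bounded A" "A \<subseteq> {x. x \<bullet> b = c}"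
    and f [measurable]: "f \<in> borel_measurable borel"
  shows "(\<integral>\<^sup>+x\<in>A. f x \<partial>hausdorff_measure (DIM('a) - 1))
    = (\<integral>\<^sup>+x. indicator {0..1} (x \<bullet> b) * (f (coord_upd b c x) * indicator A (coord_upd b c x)) \<partial>lborel)"
proof -
  let ?H = "hausdorff_measure (DIM('a) - 1) :: 'a measure"
  have "density ?H (indicator A) = density (flat_measure b c) (indicator A)"
  proof (rule measure_eqI)
    fix X assume "X \<in> sets (density ?H (indicator A))"
    then have [measurable]: "X \<in> sets borel" by simp
    have "emeasure ?H (A \<inter> X) = emeasure (flat_measure b c) (A \<inter> X)"
      using assms(3,4) by (intro hausdorff_measure_eq_flat_measure[OF b]) (auto intro: bounded_subset)
    then show "emeasure (density ?H (indicator A)) X = emeasure (density (flat_measure b c) (indicator A)) X"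
      by (simp add: emeasure_density indicator_inter_arith[symmetric])
  qed simp
  then have "(\<integral>\<^sup>+x. f x \<partial>density ?H (indicator A)) = (\<integral>\<^sup>+x. f x \<partial>density (flat_measure b c) (indicator A))"
    by simp
  then show ?thesis
    by (simp add: nn_integral_density nn_integral_flat_measure mult.commute[of "f _"])
qed

section \<open>Inequalities on an interval\<close>

text \<open>
  The fundamental theorem of calculus for a derivative that need not be integrable up to the end points:
  it is applied on compact subintervals, and continuity of \<open>F\<close> gives the limit.
\<close>

lemma ennreal_diff_le_nn_integral:
  fixes F g :: "real \<Rightarrow> real"
  assumes "p < q" and contF: "continuous_on {p..q} F"
    and deriv: "\<And>s. p < s \<Longrightarrow> s < q \<Longrightarrow> (F has_real_derivative F' s) (at s)"
    and le: "\<And>s. p < s \<Longrightarrow> s < q \<Longrightarrow> F' s \<le> g s"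
    and nonneg: "\<And>s. p < s \<Longrightarrow> s < q \<Longrightarrow> 0 \<le> g s"
    and contg: "continuous_on {p<..<q} g"
  shows "ennreal (F q - F p) \<le> (\<integral>\<^sup>+s. ennreal (g s) * indicator {p<..<q} s \<partial>lborel)" (is "_ \<le> ?I")
proof -
  have sub: "ennreal (F v - F u) \<le> ?I" if uv: "p < u" "u \<le> v" "v < q" for u v
  proof -
    have "(F has_vector_derivative F' s) (at s within {u..v})" if "s \<in> {u..v}" for s
      using has_field_derivative_at_within[OF deriv[of s]] uv that
      by (simp add: has_real_derivative_iff_has_vector_derivative)
    then have "(F' has_integral (F v - F u)) {u..v}"
      using uv by (intro fundamental_theorem_of_calculus) auto
    moreover have gint: "(g has_integral (integral {u..v} g)) {u..v}"
      using uv by (intro integrable_integral integrable_continuous_real continuous_on_subset[OF contg]) auto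
    ultimately have "F v - F u \<le> integral {u..v} g"
      by (rule has_integral_le) (use le uv in auto)
    moreover have "ennreal (integral {u..v} g) = (\<integral>\<^sup>+s. ennreal (g s * indicator {u..v} s) \<partial>lborel)"
      using nn_integral_has_integral_lebesgue[OF _ gint] nonneg uv
      by (simp add: mult.commute)
    moreover have "\<dots> \<le> ?I"
      using uv by (intro nn_integral_mono) (auto simp: indicator_def)
    ultimately show ?thesis by (metis ennreal_leI order_trans)
  qed
  \<comment> \<open>The factor 1/3 keeps the two shrinking end points in order.\<close>
  define e where "e = (\<lambda>n::nat. (q - p) / 3 * inverse (real (Suc n)))"
  have e: "0 < e n" "e n \<le> (q - p) / 3" for n
    using \<open>p < q\<close> by (auto simp: e_def field_simps mult_right_mono)
  have e0: "e \<longlonglongrightarrow> 0" unfolding e_def using tendsto_mult[OF tendsto_const LIMSEQ_inverse_real_of_nat, of "(q-p)/3"] by simp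
  have mem: "q - e n \<in> {p..q}" "p + e n \<in> {p..q}" for n
    using e[of n] by (auto simp: field_simps)
  have "(\<lambda>n. F (q - e n)) \<longlonglongrightarrow> F q"
    using mem \<open>p < q\<close> tendsto_diff[OF tendsto_const e0, of q]
    by (intro continuous_on_tendsto_compose[OF contF]) (auto intro!: always_eventually)
  moreover have "(\<lambda>n. F (p + e n)) \<longlonglongrightarrow> F p"
    using mem \<open>p < q\<close> tendsto_add[OF tendsto_const e0, of p]
    by (intro continuous_on_tendsto_compose[OF contF]) (auto intro!: always_eventually)
  ultimately have "(\<lambda>n. ennreal (F (q - e n) - F (p + e n))) \<longlonglongrightarrow> ennreal (F q - F p)"
    by (intro tendsto_ennrealI tendsto_diff)
  moreover have "ennreal (F (q - e n) - F (p + e n)) \<le> ?I" for n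
    using e[of n] \<open>p < q\<close> by (intro sub) (auto simp: field_simps)
  ultimately show ?thesis by (intro LIMSEQ_le_const2) auto
qed

text \<open>
  The Cauchy-Schwarz bound for \<open>f t = \<integral>\<^sub>0\<^sup>t f'\<close>. It is obtained from \<open>2 c f' - c\<^sup>2 \<le> f'\<^sup>2\<close> for the mean slope
  \<open>c = f t / t\<close>, which needs no integrability of \<open>f'\<close>.
\<close>

lemma square_le_of_zero_right:
  fixes f :: "real \<Rightarrow> real"
  assumes cont: "continuous_on {0..1} f" and f0: "f 0 = 0" and t: "0 < t" "t \<le> 1"
    and deriv: "\<And>s. 0 < s \<Longrightarrow> s < 1 \<Longrightarrow> (f has_real_derivative f' s) (at s)"
    and cont': "continuous_on {0<..<1} f'"
  shows "ennreal ((f t)\<^sup>2) \<le> ennreal t * (\<integral>\<^sup>+s. ennreal ((f' s)\<^sup>2) * indicator {0<..<1} s \<partial>lborel)"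
proof -
  define c where "c = f t / t"
  define F where "F = (\<lambda>s. 2 * c * f s - c\<^sup>2 * s)"
  have "ennreal (F t - F 0) \<le> (\<integral>\<^sup>+s. ennreal ((f' s)\<^sup>2) * indicator {0<..<t} s \<partial>lborel)"
  proof (rule ennreal_diff_le_nn_integral[OF t(1)])
    show "continuous_on {0..t} F" unfolding F_def
      using t by (intro continuous_intros continuous_on_subset[OF cont]) auto
    show "(F has_real_derivative (2 * c * f' s - c\<^sup>2)) (at s)" if "0 < s" "s < t" for s
      unfolding F_def using t that by (auto intro!: derivative_eq_intros deriv)
    show "2 * c * f' s - c\<^sup>2 \<le> (f' s)\<^sup>2" for s
      using zero_le_power2[of "f' s - c"] by (simp add: power2_diff algebra_simps)
    show "continuous_on {0<..<t} (\<lambda>s. (f' s)\<^sup>2)"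
      using t by (intro continuous_intros continuous_on_subset[OF cont']) auto
  qed auto
  also have "\<dots> \<le> (\<integral>\<^sup>+s. ennreal ((f' s)\<^sup>2) * indicator {0<..<1} s \<partial>lborel)"
    using t by (intro nn_integral_mono) (auto simp: indicator_def)
  finally have "ennreal t * ennreal (F t - F 0) \<le> ennreal t * (\<integral>\<^sup>+s. ennreal ((f' s)\<^sup>2) * indicator {0<..<1} s \<partial>lborel)"
    by (rule mult_left_mono) auto
  moreover have "t * (F t - F 0) = (f t)\<^sup>2"
    using t by (simp add: F_def c_def f0 field_simps power2_eq_square)
  ultimately show ?thesis using t by (simp add: ennreal_mult'[symmetric])
qed

lemma square_le_of_zero_left:
  fixes f :: "real \<Rightarrow> real"
  assumes cont: "continuous_on {-1..0} f" and f0: "f 0 = 0" and t: "0 < t" "t \<le> 1"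
    and deriv: "\<And>s. -1 < s \<Longrightarrow> s < 0 \<Longrightarrow> (f has_real_derivative f' s) (at s)"
    and cont': "continuous_on {-1<..<0} f'" and [measurable]: "f' \<in> borel_measurable borel"
  shows "ennreal ((f (-t))\<^sup>2) \<le> ennreal t * (\<integral>\<^sup>+s. ennreal ((f' s)\<^sup>2) * indicator {-1<..<0} s \<partial>lborel)"
proof -
  have "ennreal ((f (-t))\<^sup>2) \<le> ennreal t * (\<integral>\<^sup>+s. ennreal ((- f' (-s))\<^sup>2) * indicator {0<..<1} s \<partial>lborel)"
  proof (rule square_le_of_zero_right[where f="\<lambda>s. f (-s)"])
    show "continuous_on {0..1} (\<lambda>s. f (- s))"
      by (intro continuous_on_compose2[OF cont] continuous_intros) auto
    show "((\<lambda>s. f (- s)) has_real_derivative - f' (- s)) (at s)" if "0 < s" "s < 1" for s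
    proof -
      have "((\<lambda>s. f (- s)) has_real_derivative f' (- s) * (- 1)) (at s)"
        by (rule DERIV_chain2[where g=uminus]) (use that in \<open>auto intro!: deriv derivative_eq_intros\<close>)
      then show ?thesis by simp
    qed
    show "continuous_on {0<..<1} (\<lambda>s. - f' (- s))"
      by (intro continuous_intros continuous_on_compose2[OF cont']) auto
  qed (use f0 t in auto)
  also have "(\<integral>\<^sup>+s. ennreal ((- f' (-s))\<^sup>2) * indicator {0<..<1} s \<partial>lborel)
      = (\<integral>\<^sup>+s. ennreal ((f' s)\<^sup>2) * indicator {-1<..<0} s \<partial>lborel)"
    by (subst (2) nn_integral_real_affine[where c="-1" and t=0]) (auto intro!: nn_integral_cong simp: indicator_def)
  finally show ?thesis .
qed

lemma nn_integral_split_sign: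
  fixes f :: "real \<Rightarrow> ennreal"
  assumes [measurable]: "f \<in> borel_measurable borel"
  shows "(\<integral>\<^sup>+s. f s * indicator {-1<..<1} s \<partial>lborel)
    = (\<integral>\<^sup>+s. f s * indicator {0<..<1} s \<partial>lborel) + (\<integral>\<^sup>+s. f s * indicator {-1<..<0} s \<partial>lborel)"
proof -
  have "(\<integral>\<^sup>+s. f s * indicator {-1<..<1} s \<partial>lborel)
      = (\<integral>\<^sup>+s. f s * indicator {0<..<1} s + f s * indicator {-1<..<0} s \<partial>lborel)"
  proof (rule nn_integral_cong_AE)
    have "AE s in lborel. s \<noteq> (0::real)" by (rule AE_lborel_singleton)
    then show "AE s in lborel. f s * indicator {-1<..<1} s = f s * indicator {0<..<1} s + f s * indicator {-1<..<0} s"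
      by eventually_elim (auto simp: indicator_def)
  qed
  then show ?thesis by (simp add: nn_integral_add)
qed

lemma endpoint_squares_le_of_zero:
  fixes f :: "real \<Rightarrow> real"
  assumes cont: "continuous_on {-1..1} f" and f0: "f 0 = 0"
    and deriv: "\<And>s. -1 < s \<Longrightarrow> s < 1 \<Longrightarrow> (f has_real_derivative f' s) (at s)"
    and cont': "continuous_on {-1<..<1} f'" and [measurable]: "f' \<in> borel_measurable borel"
  shows "ennreal ((f 1)\<^sup>2 + (f (-1))\<^sup>2) \<le> (\<integral>\<^sup>+s. ennreal ((f' s)\<^sup>2) * indicator {-1<..<1} s \<partial>lborel)"
proof -
  have "ennreal ((f 1)\<^sup>2) \<le> ennreal 1 * (\<integral>\<^sup>+s. ennreal ((f' s)\<^sup>2) * indicator {0<..<1} s \<partial>lborel)"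
    by (rule square_le_of_zero_right) (auto intro: deriv f0 continuous_on_subset[OF cont] continuous_on_subset[OF cont'])
  moreover have "ennreal ((f (-1))\<^sup>2) \<le> ennreal 1 * (\<integral>\<^sup>+s. ennreal ((f' s)\<^sup>2) * indicator {-1<..<0} s \<partial>lborel)"
    by (rule square_le_of_zero_left) (auto intro: deriv f0 continuous_on_subset[OF cont] continuous_on_subset[OF cont'])
  ultimately show ?thesis
    by (simp add: nn_integral_split_sign add_mono)
qed

text \<open>
  Integrating \<open>f(t)\<^sup>2 \<le> t \<integral>\<^sub>0\<^sup>1 f'\<^sup>2\<close> over \<open>t\<close> gives the constant 2, which is what the trace
  inequality below requires.
\<close>

lemma poincare_of_zero:
  fixes f :: "real \<Rightarrow> real"
  assumes cont: "continuous_on {-1..1} f" and f0: "f 0 = 0"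
    and deriv: "\<And>s. -1 < s \<Longrightarrow> s < 1 \<Longrightarrow> (f has_real_derivative f' s) (at s)"
    and cont': "continuous_on {-1<..<1} f'"
    and [measurable]: "f \<in> borel_measurable borel" "f' \<in> borel_measurable borel"
  shows "2 * (\<integral>\<^sup>+s. ennreal ((f s)\<^sup>2) * indicator {-1<..<1} s \<partial>lborel)
    \<le> (\<integral>\<^sup>+s. ennreal ((f' s)\<^sup>2) * indicator {-1<..<1} s \<partial>lborel)"
proof -
  let ?R = "\<integral>\<^sup>+s. ennreal ((f' s)\<^sup>2) * indicator {0<..<1} s \<partial>lborel"
  let ?L = "\<integral>\<^sup>+s. ennreal ((f' s)\<^sup>2) * indicator {-1<..<0} s \<partial>lborel"
  \<comment> \<open>The integral that produces the constant 2.\<close>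
  have half: "(\<integral>\<^sup>+t. ennreal t * indicator {0..1} t \<partial>lborel) = ennreal (1/2)"
  proof -
    have "((\<lambda>t::real. t) has_integral 1/2) {0..1}"
      using ident_has_integral[of 0 "1::real"] by simp
    from nn_integral_has_integral_lebesgue[OF _ this]
    show ?thesis by (simp add: ennreal_indicator ennreal_mult'' mult.commute)
  qed
  have two: "2 * a \<le> c" if "a \<le> ennreal (1/2) * c" for a c
  proof -
    have "2 * ennreal (1/2) = 1"
      by (subst ennreal_numeral[symmetric], subst ennreal_mult[symmetric]) auto
    then have "2 * (ennreal (1/2) * c) = c" by (simp only: mult.assoc[symmetric] mult_1)
    then show ?thesis using mult_left_mono[OF that, of 2] by (simp only: zero_le simp_thms)
  qed
  have "(\<integral>\<^sup>+s. ennreal ((f s)\<^sup>2) * indicator {0<..<1} s \<partial>lborel) \<le> (\<integral>\<^sup>+t. (ennreal t * indicator {0..1} t) * ?R \<partial>lborel)"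
  proof (rule nn_integral_mono)
    fix t :: real
    show "ennreal ((f t)\<^sup>2) * indicator {0<..<1} t \<le> (ennreal t * indicator {0..1} t) * ?R"
    proof (cases "t \<in> {0<..<1}")
      case True
      have "ennreal ((f t)\<^sup>2) \<le> ennreal t * ?R"
        using True by (intro square_le_of_zero_right) (auto intro: deriv f0 continuous_on_subset[OF cont] continuous_on_subset[OF cont'])
      then show ?thesis using True by simp
    qed simp
  qed
  also have "\<dots> = ennreal (1/2) * ?R" by (subst nn_integral_multc) (auto simp: half)
  finally have R: "2 * (\<integral>\<^sup>+s. ennreal ((f s)\<^sup>2) * indicator {0<..<1} s \<partial>lborel) \<le> ?R"
    by (rule two)
  have "(\<integral>\<^sup>+s. ennreal ((f s)\<^sup>2) * indicator {-1<..<0} s \<partial>lborel)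
      = (\<integral>\<^sup>+s. ennreal ((f (-s))\<^sup>2) * indicator {0<..<1} s \<partial>lborel)"
    by (subst nn_integral_real_affine[where c="-1" and t=0], measurable)
      (auto intro!: nn_integral_cong simp: indicator_def)
  also have "\<dots> \<le> (\<integral>\<^sup>+t. (ennreal t * indicator {0..1} t) * ?L \<partial>lborel)"
  proof (rule nn_integral_mono)
    fix t :: real
    show "ennreal ((f (-t))\<^sup>2) * indicator {0<..<1} t \<le> (ennreal t * indicator {0..1} t) * ?L"
    proof (cases "t \<in> {0<..<1}")
      case True
      have "ennreal ((f (-t))\<^sup>2) \<le> ennreal t * ?L"
        using True by (intro square_le_of_zero_left) (auto intro: deriv f0 continuous_on_subset[OF cont] continuous_on_subset[OF cont'])
      then show ?thesis using True by simp
    qed simp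
  qed
  also have "\<dots> = ennreal (1/2) * ?L" by (subst nn_integral_multc) (auto simp: half)
  finally have L: "2 * (\<integral>\<^sup>+s. ennreal ((f s)\<^sup>2) * indicator {-1<..<0} s \<partial>lborel) \<le> ?L"
    by (rule two)
  show ?thesis using R L by (simp add: nn_integral_split_sign distrib_left add_mono)
qed

text \<open>
  The boundary values are those of \<open>s f(s)\<^sup>2\<close>, whose derivative \<open>f\<^sup>2 + 2 s f f'\<close> is at most \<open>2 f\<^sup>2 + f'\<^sup>2\<close> for
  \<open>|s| \<le> 1\<close>.
\<close>

lemma endpoint_squares_le:
  fixes f :: "real \<Rightarrow> real"
  assumes cont: "continuous_on {-1..1} f"
    and deriv: "\<And>s. -1 < s \<Longrightarrow> s < 1 \<Longrightarrow> (f has_real_derivative f' s) (at s)"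
    and cont': "continuous_on {-1<..<1} f'"
  shows "ennreal ((f 1)\<^sup>2 + (f (-1))\<^sup>2)
    \<le> (\<integral>\<^sup>+s. ennreal (2 * (f s)\<^sup>2 + (f' s)\<^sup>2) * indicator {-1<..<1} s \<partial>lborel)"
proof -
  define F where "F = (\<lambda>s. s * (f s)\<^sup>2)"
  have "ennreal (F 1 - F (-1)) \<le> (\<integral>\<^sup>+s. ennreal (2 * (f s)\<^sup>2 + (f' s)\<^sup>2) * indicator {-1<..<1} s \<partial>lborel)"
  proof (rule ennreal_diff_le_nn_integral)
    show "continuous_on {-1..1} F" unfolding F_def by (intro continuous_intros cont)
    show "(F has_real_derivative ((f s)\<^sup>2 + 2 * (s * f s) * f' s)) (at s)" if "-1 < s" "s < 1" for s
      unfolding F_def using that by (auto intro!: derivative_eq_intros deriv simp: algebra_simps power2_eq_square)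
    show "(f s)\<^sup>2 + 2 * (s * f s) * f' s \<le> 2 * (f s)\<^sup>2 + (f' s)\<^sup>2" if "-1 < s" "s < 1" for s
    proof -
      have "2 * (s * f s) * f' s \<le> (s * f s)\<^sup>2 + (f' s)\<^sup>2"
        using zero_le_power2[of "s * f s - f' s"] by (simp add: power2_diff)
      moreover have "s\<^sup>2 * (f s)\<^sup>2 \<le> 1 * (f s)\<^sup>2"
        using that by (intro mult_right_mono) (auto simp: abs_square_le_1)
      ultimately show ?thesis by (simp add: power_mult_distrib)
    qed
    show "continuous_on {-1<..<1} (\<lambda>s. 2 * (f s)\<^sup>2 + (f' s)\<^sup>2)"
      by (intro continuous_intros cont' continuous_on_subset[OF cont]) auto
  qed auto
  then show ?thesis by (simp add: F_def)
qed

section \<open>Faces against gradients on the cube\<close>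

abbreviation closed_cube :: "'a::euclidean_space set" where "closed_cube \<equiv> cbox (- One) One"
abbreviation open_cube :: "'a::euclidean_space set" where "open_cube \<equiv> box (- One) One"

lemma mem_closed_cube: "x \<in> closed_cube \<longleftrightarrow> (\<forall>k\<in>Basis. \<bar>x \<bullet> k\<bar> \<le> 1)"
  by (auto simp: mem_box abs_le_iff)

lemma mem_open_cube: "x \<in> open_cube \<longleftrightarrow> (\<forall>k\<in>Basis. \<bar>x \<bullet> k\<bar> < 1)"
  by (auto simp: mem_box abs_less_iff)

text \<open>
  The open faces orthogonal to \<open>b\<close> are the points of this set with \<open>x \<bullet> b = 1\<close> or \<open>x \<bullet> b = -1\<close>.
\<close>

definition strip :: "'a::euclidean_space \<Rightarrow> 'a set" where
  "strip b = {x. \<forall>k\<in>Basis-{b}. \<bar>x \<bullet> k\<bar> < 1}"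

lemma sets_strip [measurable]: "strip b \<in> sets borel"
proof -
  have "strip b = (\<Inter>k\<in>Basis-{b}. {x. \<bar>x \<bullet> k\<bar> < 1})" by (auto simp: strip_def)
  moreover have "open (\<Inter>k\<in>Basis-{b}. {x. \<bar>x \<bullet> k\<bar> < 1})"
    by (intro open_INT ballI open_Collect_less continuous_intros) auto
  ultimately show ?thesis by simp
qed

lemma coord_upd_mem_open_cube:
  "b \<in> Basis \<Longrightarrow> coord_upd b s x \<in> open_cube \<longleftrightarrow> x \<in> strip b \<and> \<bar>s\<bar> < 1"
  by (auto simp: mem_open_cube strip_def inner_coord_upd split: if_splits)

lemma coord_upd_mem_closed_cube:
  "b \<in> Basis \<Longrightarrow> x \<in> strip b \<Longrightarrow> \<bar>s\<bar> \<le> 1 \<Longrightarrow> coord_upd b s x \<in> closed_cube"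
  by (auto simp: mem_closed_cube strip_def inner_coord_upd less_imp_le split: if_splits)

lemma flip_mem_open_cube [simp]: "b \<in> Basis \<Longrightarrow> flip b x \<in> open_cube \<longleftrightarrow> x \<in> open_cube"
  by (auto simp: mem_open_cube inner_flip split: if_splits)

lemma flip_mem_closed_cube [simp]: "b \<in> Basis \<Longrightarrow> flip b x \<in> closed_cube \<longleftrightarrow> x \<in> closed_cube"
  by (auto simp: mem_closed_cube inner_flip split: if_splits)

lemma flip_mem_strip: "b \<in> Basis \<Longrightarrow> k \<in> Basis \<Longrightarrow> flip k x \<in> strip b \<longleftrightarrow> x \<in> strip b"
  by (auto simp: strip_def inner_flip split: if_splits)

lemma flip_eq: "flip b x = x - (2 * (x \<bullet> b)) *\<^sub>R b"
  by (simp add: flip_def coord_upd_def algebra_simps)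

lemma bounded_linear_flip: "bounded_linear (flip b)"
  unfolding flip_eq by (intro bounded_linear_intros)

lemma measurable_flip [measurable]: "flip b \<in> borel_measurable borel"
  by (intro borel_measurable_continuous_onI linear_continuous_on bounded_linear_flip)

lemma flip_inner: "flip b x \<bullet> y = x \<bullet> flip b y"
  by (simp add: flip_eq inner_diff_left inner_diff_right inner_commute)

lemma norm_flip: "b \<in> Basis \<Longrightarrow> norm (flip b x) = norm x"
  by (simp add: norm_eq_sqrt_inner flip_inner)

lemma flip_uminus: "flip b (- x) = - flip b x"
  by (simp add: flip_eq)

lemma flip_comm: "b \<in> Basis \<Longrightarrow> k \<in> Basis \<Longrightarrow> flip b (flip k x) = flip k (flip b x)"
  by (rule euclidean_eqI) (simp add: inner_flip)

lemma flip_coord_upd_same: "b \<in> Basis \<Longrightarrow> flip b (coord_upd b s x) = coord_upd b (- s) x"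
  by (rule euclidean_eqI) (simp add: inner_flip inner_coord_upd)

lemma flip_coord_upd_other:
  "b \<in> Basis \<Longrightarrow> k \<in> Basis \<Longrightarrow> k \<noteq> b \<Longrightarrow> flip k (coord_upd b s x) = coord_upd b s (flip k x)"
  by (rule euclidean_eqI) (simp add: inner_flip inner_coord_upd)

lemma nn_integral_flip:
  fixes f :: "'a::euclidean_space \<Rightarrow> ennreal"
  assumes b: "b \<in> Basis" and [measurable]: "f \<in> borel_measurable borel"
  shows "(\<integral>\<^sup>+x. f (flip b x) \<partial>lborel) = (\<integral>\<^sup>+x. f x \<partial>lborel)"
proof -
  have "(\<integral>\<^sup>+s. f (flip b (coord_upd b s x)) \<partial>lborel) = (\<integral>\<^sup>+s. f (coord_upd b s x) \<partial>lborel)" for x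
    using b by (subst (2) nn_integral_real_affine[where c="-1" and t=0]) (auto simp: flip_coord_upd_same)
  then show ?thesis
    by (subst (1 2) nn_integral_lborel_slice[OF b]) auto
qed

text \<open>
  A function on the cube together with its gradient in the interior. The values off the cube are
  irrelevant, but requiring measurability on the whole space spares all later measurability
  arguments on subsets.
\<close>

definition cube_pair :: "('a::euclidean_space \<Rightarrow> real) \<Rightarrow> ('a \<Rightarrow> 'a) \<Rightarrow> bool" where
  "cube_pair w G \<longleftrightarrow> continuous_on closed_cube w \<and> continuous_on open_cube G
    \<and> (\<forall>x\<in>open_cube. (w has_derivative (\<lambda>h. G x \<bullet> h)) (at x))
    \<and> w \<in> borel_measurable borel \<and> G \<in> borel_measurable borel"

lemma cube_pairD:
  assumes "cube_pair w G"
  shows "continuous_on closed_cube w" "continuous_on open_cube G"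
    "x \<in> open_cube \<Longrightarrow> (w has_derivative (\<lambda>h. G x \<bullet> h)) (at x)"
    "w \<in> borel_measurable borel" "G \<in> borel_measurable borel"
  using assms by (auto simp: cube_pair_def)

text \<open>
  The integral of \<open>w\<^sup>2\<close> over the two open faces orthogonal to \<open>b\<close>, written as an integral over the slab
  \<open>0 \<le> x \<bullet> b \<le> 1\<close>; this is the form in which it can be compared slice by slice with integrals over the
  cube.
\<close>

definition face_energy :: "'a::euclidean_space \<Rightarrow> ('a \<Rightarrow> real) \<Rightarrow> ennreal" where
  "face_energy b w = (\<integral>\<^sup>+x. indicator {0..1} (x \<bullet> b) * (indicator (strip b) x *
     ennreal ((w (coord_upd b 1 x))\<^sup>2 + (w (coord_upd b (-1) x))\<^sup>2)) \<partial>lborel)"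

definition dirichlet_energy :: "('a::euclidean_space \<Rightarrow> 'a) \<Rightarrow> ennreal" where
  "dirichlet_energy G = (\<integral>\<^sup>+x. ennreal ((norm (G x))\<^sup>2) * indicator open_cube x \<partial>lborel)"

lemma cube_pair_line:
  assumes w: "cube_pair w G" and b: "b \<in> Basis" and x: "x \<in> strip b"
  shows "continuous_on {-1..1} (\<lambda>s. w (coord_upd b s x))"
    and "-1 < s \<Longrightarrow> s < 1 \<Longrightarrow> ((\<lambda>s. w (coord_upd b s x)) has_real_derivative (G (coord_upd b s x) \<bullet> b)) (at s)"
    and "continuous_on {-1<..<1} (\<lambda>s. G (coord_upd b s x) \<bullet> b)"
proof -
  have c: "continuous_on A (\<lambda>s. coord_upd b s x)" for A
    unfolding coord_upd_def by (intro continuous_intros)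
  show "continuous_on {-1..1} (\<lambda>s. w (coord_upd b s x))"
    by (rule continuous_on_compose2[OF cube_pairD(1)[OF w] c]) (use coord_upd_mem_closed_cube[OF b x] in \<open>auto simp del: mem_box\<close>)
  have "continuous_on {-1<..<1} (\<lambda>s. G (coord_upd b s x))"
    by (rule continuous_on_compose2[OF cube_pairD(2)[OF w] c]) (use coord_upd_mem_open_cube[OF b] x in auto)
  then show "continuous_on {-1<..<1} (\<lambda>s. G (coord_upd b s x) \<bullet> b)" by (intro continuous_intros)
  show "((\<lambda>s. w (coord_upd b s x)) has_real_derivative (G (coord_upd b s x) \<bullet> b)) (at s)" if "-1 < s" "s < 1"
  proof -
    have "coord_upd b s x \<in> open_cube" using that x by (auto simp: coord_upd_mem_open_cube[OF b])
    then have "(w has_derivative (\<lambda>h. G (coord_upd b s x) \<bullet> h)) (at (coord_upd b s x))"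
      by (rule cube_pairD(3)[OF w])
    moreover have "((\<lambda>s. coord_upd b s x) has_derivative (\<lambda>t. t *\<^sub>R b)) (at s)"
      unfolding coord_upd_def by (auto intro!: derivative_eq_intros)
    ultimately have "((\<lambda>s. w (coord_upd b s x)) has_derivative (\<lambda>t. G (coord_upd b s x) \<bullet> (t *\<^sub>R b))) (at s)"
      using has_derivative_compose by blast
    then show ?thesis by (simp add: has_field_derivative_def mult.commute[of _ "G _ \<bullet> b"] mult_commute_abs)
  qed
qed

lemma nn_integral_open_cube_slice:
  fixes f :: "'a::euclidean_space \<Rightarrow> ennreal"
  assumes b: "b \<in> Basis" and [measurable]: "f \<in> borel_measurable borel"
  shows "(\<integral>\<^sup>+x. f x * indicator open_cube x \<partial>lborel) = (\<integral>\<^sup>+x. indicator {0..1} (x \<bullet> b) *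
     (indicator (strip b) x * (\<integral>\<^sup>+s. f (coord_upd b s x) * indicator {-1<..<1} s \<partial>lborel)) \<partial>lborel)"
proof -
  have "indicator open_cube (coord_upd b s x) = (indicator (strip b) x * indicator {-1<..<1} s :: ennreal)" for s x
    using coord_upd_mem_open_cube[OF b, of s x] by (auto simp: indicator_def)
  then have "(\<integral>\<^sup>+s. f (coord_upd b s x) * indicator open_cube (coord_upd b s x) \<partial>lborel)
      = indicator (strip b) x * (\<integral>\<^sup>+s. f (coord_upd b s x) * indicator {-1<..<1} s \<partial>lborel)" for x
    by (simp add: nn_integral_cmult[symmetric] mult_ac)
  then show ?thesis by (subst nn_integral_lborel_slice[OF b]) auto
qed

lemma face_energy_le_of_zero:
  assumes w: "cube_pair w G" and b: "b \<in> Basis" and zero: "\<And>x. x \<in> strip b \<Longrightarrow> w (coord_upd b 0 x) = 0"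
  shows "face_energy b w \<le> (\<integral>\<^sup>+x. ennreal ((G x \<bullet> b)\<^sup>2) * indicator open_cube x \<partial>lborel)"
proof -
  note [measurable] = cube_pairD(4,5)[OF w]
  show ?thesis
    unfolding face_energy_def
  proof (subst nn_integral_open_cube_slice[OF b], measurable, rule nn_integral_mono, rule mult_left_mono)
    fix x
    show "indicator (strip b) x * ennreal ((w (coord_upd b 1 x))\<^sup>2 + (w (coord_upd b (-1) x))\<^sup>2)
      \<le> indicator (strip b) x * (\<integral>\<^sup>+s. ennreal ((G (coord_upd b s x) \<bullet> b)\<^sup>2) * indicator {-1<..<1} s \<partial>lborel)"
    proof (cases "x \<in> strip b")
      case True
      then show ?thesis
        using endpoint_squares_le_of_zero[OF cube_pair_line(1)[OF w b True] zero[OF True] cube_pair_line(2,3)[OF w b True]]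
        by simp
    qed simp
  qed simp
qed

lemma face_energy_le:
  assumes w: "cube_pair w G" and b: "b \<in> Basis"
  shows "face_energy b w \<le> (\<integral>\<^sup>+x. ennreal (2 * (w x)\<^sup>2 + (G x \<bullet> b)\<^sup>2) * indicator open_cube x \<partial>lborel)"
proof -
  note [measurable] = cube_pairD(4,5)[OF w]
  show ?thesis
    unfolding face_energy_def
  proof (subst nn_integral_open_cube_slice[OF b], measurable, rule nn_integral_mono, rule mult_left_mono)
    fix x
    show "indicator (strip b) x * ennreal ((w (coord_upd b 1 x))\<^sup>2 + (w (coord_upd b (-1) x))\<^sup>2)
      \<le> indicator (strip b) x * (\<integral>\<^sup>+s. ennreal (2 * (w (coord_upd b s x))\<^sup>2 + (G (coord_upd b s x) \<bullet> b)\<^sup>2) * indicator {-1<..<1} s \<partial>lborel)"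
    proof (cases "x \<in> strip b")
      case True
      then show ?thesis using endpoint_squares_le[OF cube_pair_line[OF w b True]] by simp
    qed simp
  qed simp
qed

lemma poincare_cube_of_zero:
  assumes w: "cube_pair w G" and b: "b \<in> Basis" and zero: "\<And>x. x \<in> strip b \<Longrightarrow> w (coord_upd b 0 x) = 0"
  shows "(\<integral>\<^sup>+x. ennreal (2 * (w x)\<^sup>2) * indicator open_cube x \<partial>lborel)
    \<le> (\<integral>\<^sup>+x. ennreal ((G x \<bullet> b)\<^sup>2) * indicator open_cube x \<partial>lborel)"
proof -
  note [measurable] = cube_pairD(4,5)[OF w]
  have "indicator (strip b) x * (\<integral>\<^sup>+s. ennreal (2 * (w (coord_upd b s x))\<^sup>2) * indicator {-1<..<1} s \<partial>lborel)
      \<le> indicator (strip b) x * (\<integral>\<^sup>+s. ennreal ((G (coord_upd b s x) \<bullet> b)\<^sup>2) * indicator {-1<..<1} s \<partial>lborel)" for x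
  proof (cases "x \<in> strip b")
    case True
    have "(\<integral>\<^sup>+s. ennreal (2 * (w (coord_upd b s x))\<^sup>2) * indicator {-1<..<1} s \<partial>lborel)
        = 2 * (\<integral>\<^sup>+s. ennreal ((w (coord_upd b s x))\<^sup>2) * indicator {-1<..<1} s \<partial>lborel)"
      by (subst nn_integral_cmult[symmetric]) (auto simp: ennreal_mult' mult.assoc intro!: nn_integral_cong)
    also have "\<dots> \<le> (\<integral>\<^sup>+s. ennreal ((G (coord_upd b s x) \<bullet> b)\<^sup>2) * indicator {-1<..<1} s \<partial>lborel)"
      by (rule poincare_of_zero[OF cube_pair_line(1)[OF w b True] zero[OF True] cube_pair_line(2,3)[OF w b True]]) measurable
    finally show ?thesis using True by simp
  qed simp
  then have "(\<integral>\<^sup>+x. indicator {0..1} (x \<bullet> b) * (indicator (strip b) x *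
        (\<integral>\<^sup>+s. ennreal (2 * (w (coord_upd b s x))\<^sup>2) * indicator {-1<..<1} s \<partial>lborel)) \<partial>lborel)
      \<le> (\<integral>\<^sup>+x. indicator {0..1} (x \<bullet> b) * (indicator (strip b) x *
        (\<integral>\<^sup>+s. ennreal ((G (coord_upd b s x) \<bullet> b)\<^sup>2) * indicator {-1<..<1} s \<partial>lborel)) \<partial>lborel)"
    by (rule nn_integral_mono[OF mult_left_mono]) simp
  then show ?thesis
    by (subst (1 2) nn_integral_open_cube_slice[OF b]) simp_all
qed

lemma sum_coordinates_le_norm:
  fixes v :: "'a::euclidean_space"
  assumes "S \<subseteq> Basis"
  shows "(\<Sum>k\<in>S. (v \<bullet> k)\<^sup>2) \<le> (norm v)\<^sup>2"
proof -
  have "(norm v)\<^sup>2 = (\<Sum>k\<in>Basis. (v \<bullet> k)\<^sup>2)"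
    unfolding power2_norm_eq_inner by (subst euclidean_inner) (simp add: power2_eq_square)
  then show ?thesis using assms by (simp add: sum_mono2)
qed

text \<open>
  For \<open>j = b\<close> the component of the gradient along \<open>b\<close> suffices. For \<open>j \<noteq> b\<close> the trace inequality in
  direction \<open>b\<close> leaves the term \<open>2 w\<^sup>2\<close>, which the Poincare inequality in direction \<open>j\<close> absorbs into
  another component of the gradient.
\<close>

lemma face_energy_le_of_odd_coordinate:
  assumes w: "cube_pair w G" and b: "b \<in> Basis" and j: "j \<in> Basis"
    and odd: "\<And>x. x \<in> closed_cube \<Longrightarrow> w (flip j x) = - w x"
  shows "face_energy b w \<le> dirichlet_energy G"
proof -
  note [measurable] = cube_pairD(4,5)[OF w]
  have zero: "w (coord_upd j 0 x) = 0" if "x \<in> strip j" for x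
    using odd[of "coord_upd j 0 x"] coord_upd_mem_closed_cube[OF j that, of 0] j by (simp add: flip_coord_upd_same)
  show ?thesis
  proof (cases "j = b")
    case True
    have "face_energy b w \<le> (\<integral>\<^sup>+x. ennreal ((G x \<bullet> b)\<^sup>2) * indicator open_cube x \<partial>lborel)"
      by (rule face_energy_le_of_zero[OF w b]) (use zero True in auto)
    also have "\<dots> \<le> dirichlet_energy G"
      unfolding dirichlet_energy_def using sum_coordinates_le_norm[of "{b}"] b
      by (intro nn_integral_mono mult_right_mono ennreal_leI) auto
    finally show ?thesis .
  next
    case False
    have "face_energy b w \<le> (\<integral>\<^sup>+x. ennreal (2 * (w x)\<^sup>2 + (G x \<bullet> b)\<^sup>2) * indicator open_cube x \<partial>lborel)"
      by (rule face_energy_le[OF w b])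
    also have "\<dots> = (\<integral>\<^sup>+x. ennreal (2 * (w x)\<^sup>2) * indicator open_cube x \<partial>lborel)
        + (\<integral>\<^sup>+x. ennreal ((G x \<bullet> b)\<^sup>2) * indicator open_cube x \<partial>lborel)"
      by (subst nn_integral_add[symmetric]) (auto simp: distrib_right)
    also have "\<dots> \<le> (\<integral>\<^sup>+x. ennreal ((G x \<bullet> j)\<^sup>2) * indicator open_cube x \<partial>lborel)
        + (\<integral>\<^sup>+x. ennreal ((G x \<bullet> b)\<^sup>2) * indicator open_cube x \<partial>lborel)"
      by (intro add_right_mono poincare_cube_of_zero[OF w j] zero)
    also have "\<dots> = (\<integral>\<^sup>+x. ennreal ((G x \<bullet> j)\<^sup>2 + (G x \<bullet> b)\<^sup>2) * indicator open_cube x \<partial>lborel)"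
      by (subst nn_integral_add[symmetric]) (auto simp: distrib_right)
    also have "\<dots> \<le> dirichlet_energy G"
      unfolding dirichlet_energy_def using sum_coordinates_le_norm[of "{j, b}"] b j False
      by (intro nn_integral_mono mult_right_mono ennreal_leI) auto
    finally show ?thesis .
  qed
qed

lemma cube_pair_flip:
  assumes w: "cube_pair w G" and j: "j \<in> Basis"
  shows "cube_pair (\<lambda>x. w (flip j x)) (\<lambda>x. flip j (G (flip j x)))"
  unfolding cube_pair_def
proof (intro conjI ballI)
  note [measurable] = cube_pairD(4,5)[OF w]
  have c: "continuous_on A (flip j)" for A by (intro linear_continuous_on bounded_linear_flip)
  show "continuous_on closed_cube (\<lambda>x. w (flip j x))"
    by (rule continuous_on_compose2[OF cube_pairD(1)[OF w] c]) (use j in \<open>auto simp del: mem_box\<close>)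
  show "continuous_on open_cube (\<lambda>x. flip j (G (flip j x)))"
    by (rule continuous_on_compose2[OF c continuous_on_compose2[OF cube_pairD(2)[OF w] c]]) (use j in \<open>auto simp del: mem_box\<close>)
  show "(\<lambda>x. w (flip j x)) \<in> borel_measurable borel" "(\<lambda>x. flip j (G (flip j x))) \<in> borel_measurable borel"
    by measurable
  fix x :: 'a assume "x \<in> open_cube"
  then have "(w has_derivative (\<lambda>h. G (flip j x) \<bullet> h)) (at (flip j x))"
    using j by (intro cube_pairD(3)[OF w]) simp
  then have "((\<lambda>x. w (flip j x)) has_derivative (\<lambda>h. G (flip j x) \<bullet> flip j h)) (at x)"
    using has_derivative_compose[OF bounded_linear_imp_has_derivative[OF bounded_linear_flip]] by blast
  then show "((\<lambda>x. w (flip j x)) has_derivative (\<lambda>h. flip j (G (flip j x)) \<bullet> h)) (at x)"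
    by (simp add: flip_inner)
qed

lemma cube_pair_combine:
  assumes w: "cube_pair w G" and v: "cube_pair v H"
  shows "cube_pair (\<lambda>x. p * w x + q * v x) (\<lambda>x. p *\<^sub>R G x + q *\<^sub>R H x)"
  unfolding cube_pair_def
proof (intro conjI ballI)
  note [measurable] = cube_pairD(4,5)[OF w] cube_pairD(4,5)[OF v]
  show "continuous_on closed_cube (\<lambda>x. p * w x + q * v x)"
    by (intro continuous_intros cube_pairD(1)[OF w] cube_pairD(1)[OF v])
  show "continuous_on open_cube (\<lambda>x. p *\<^sub>R G x + q *\<^sub>R H x)"
    by (intro continuous_intros cube_pairD(2)[OF w] cube_pairD(2)[OF v])
  show "(\<lambda>x. p * w x + q * v x) \<in> borel_measurable borel"
    "(\<lambda>x. p *\<^sub>R G x + q *\<^sub>R H x) \<in> borel_measurable borel"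
    by measurable
  fix x :: 'a assume x: "x \<in> open_cube"
  show "((\<lambda>x. p * w x + q * v x) has_derivative (\<lambda>h. (p *\<^sub>R G x + q *\<^sub>R H x) \<bullet> h)) (at x)"
    by (auto intro!: derivative_eq_intros cube_pairD(3)[OF w x] cube_pairD(3)[OF v x] simp: inner_add_left)
qed

lemma dirichlet_energy_flip:
  assumes j: "j \<in> Basis" and [measurable]: "G \<in> borel_measurable borel"
  shows "dirichlet_energy (\<lambda>x. flip j (G (flip j x))) = dirichlet_energy G"
  unfolding dirichlet_energy_def
  by (subst (2) nn_integral_flip[OF j, symmetric]) (use j in \<open>auto simp: norm_flip indicator_def\<close>)

lemma face_energy_flip:
  assumes b: "b \<in> Basis" and j: "j \<in> Basis" and [measurable]: "w \<in> borel_measurable borel"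
  shows "face_energy b (\<lambda>x. w (flip j x)) = face_energy b w"
proof (cases "j = b")
  case True
  then show ?thesis unfolding face_energy_def using b by (simp add: flip_coord_upd_same add.commute)
next
  case False
  then show ?thesis unfolding face_energy_def
    by (subst (2) nn_integral_flip[OF j, symmetric])
      (use b j in \<open>auto simp: flip_coord_upd_other flip_mem_strip indicator_def inner_flip\<close>)
qed

lemma ennreal_eq_of_double_eq:
  fixes a b :: ennreal
  assumes "2 * a = b + b"
  shows "a = b"
proof -
  have "2 * a = 2 * b" using assms by (simp add: mult_2)
  then show ?thesis by (simp add: ennreal_mult_cancel_left)
qed

text \<open>
  The parallelogram law, integrated, with the invariance of the energy under the reflection.
\<close>

lemma dirichlet_energy_parity:
  assumes j: "j \<in> Basis" and [measurable]: "G \<in> borel_measurable borel"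
  shows "dirichlet_energy (\<lambda>x. (1/2) *\<^sub>R G x + (1/2) *\<^sub>R flip j (G (flip j x)))
    + dirichlet_energy (\<lambda>x. (1/2) *\<^sub>R G x + (-1/2) *\<^sub>R flip j (G (flip j x))) = dirichlet_energy G"
proof -
  let ?R = "\<lambda>x. flip j (G (flip j x))"
  have pt: "2 * ((norm ((1/2) *\<^sub>R u + (1/2) *\<^sub>R v))\<^sup>2 + (norm ((1/2) *\<^sub>R u + (-1/2) *\<^sub>R v))\<^sup>2)
      = (norm u)\<^sup>2 + (norm v)\<^sup>2" for u v :: 'a
    unfolding power2_norm_eq_inner by (simp add: inner_add_left inner_add_right inner_commute algebra_simps)
  have "2 * (dirichlet_energy (\<lambda>x. (1/2) *\<^sub>R G x + (1/2) *\<^sub>R ?R x) + dirichlet_energy (\<lambda>x. (1/2) *\<^sub>R G x + (-1/2) *\<^sub>R ?R x))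
    = (\<integral>\<^sup>+x. ennreal (2 * ((norm ((1/2) *\<^sub>R G x + (1/2) *\<^sub>R ?R x))\<^sup>2 + (norm ((1/2) *\<^sub>R G x + (-1/2) *\<^sub>R ?R x))\<^sup>2)) * indicator open_cube x \<partial>lborel)"
    unfolding dirichlet_energy_def
    by (subst nn_integral_add[symmetric], measurable, subst nn_integral_cmult[symmetric], measurable)
       (intro nn_integral_cong, simp add: ennreal_mult' distrib_right mult.assoc)
  also have "\<dots> = dirichlet_energy G + dirichlet_energy ?R"
    unfolding dirichlet_energy_def pt
    by (subst nn_integral_add[symmetric]) (auto simp: distrib_right)
  also have "\<dots> = dirichlet_energy G + dirichlet_energy G" by (simp add: dirichlet_energy_flip[OF j])
  finally show ?thesis by (rule ennreal_eq_of_double_eq)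
qed

lemma face_energy_parity:
  assumes b: "b \<in> Basis" and j: "j \<in> Basis" and [measurable]: "w \<in> borel_measurable borel"
  shows "face_energy b (\<lambda>x. (1/2) * w x + (1/2) * w (flip j x))
    + face_energy b (\<lambda>x. (1/2) * w x + (-1/2) * w (flip j x)) = face_energy b w"
proof -
  let ?e = "\<lambda>x. (1/2) * w x + (1/2) * w (flip j x)" and ?o = "\<lambda>x. (1/2) * w x + (-1/2) * w (flip j x)"
  let ?t = "\<lambda>w x. (w (coord_upd b 1 x))\<^sup>2 + (w (coord_upd b (-1) x))\<^sup>2 :: real"
  have pt: "2 * (?t ?e x + ?t ?o x) = ?t w x + ?t (\<lambda>x. w (flip j x)) x" for x
    by (simp add: power2_eq_square algebra_simps)
  have "2 * (face_energy b ?e + face_energy b ?o)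
    = (\<integral>\<^sup>+x. indicator {0..1} (x \<bullet> b) * (indicator (strip b) x * ennreal (2 * (?t ?e x + ?t ?o x))) \<partial>lborel)"
    unfolding face_energy_def
    by (subst nn_integral_add[symmetric], measurable, subst nn_integral_cmult[symmetric], measurable)
       (intro nn_integral_cong, simp add: ennreal_mult' distrib_left mult_ac)
  also have "\<dots> = face_energy b w + face_energy b (\<lambda>x. w (flip j x))"
    unfolding face_energy_def pt
    by (subst nn_integral_add[symmetric]) (auto simp: distrib_left)
  also have "\<dots> = face_energy b w + face_energy b w" by (simp add: face_energy_flip[OF b j])
  finally show ?thesis by (rule ennreal_eq_of_double_eq)
qed

text \<open>
  Induction on the set \<open>C\<close> of coordinates in which \<open>w\<close> is not known to be even. A coordinate \<open>j\<close> in \<open>C\<close>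
  is removed by splitting \<open>w\<close> into its even part, to which the induction hypothesis applies, and its
  odd part, which is covered by the preceding case. When \<open>C\<close> is empty, \<open>w(-x) = w(x)\<close>, so the odd function
  \<open>w\<close> vanishes on the cube.
\<close>

theorem face_energy_le_dirichlet_energy:
  fixes w :: "'a::euclidean_space \<Rightarrow> real"
  assumes b: "b \<in> Basis" and w: "cube_pair w G" and odd: "\<And>x. x \<in> closed_cube \<Longrightarrow> w (- x) = - w x"
  shows "face_energy b w \<le> dirichlet_energy G"
proof -
  have "face_energy b w \<le> dirichlet_energy G"
    if "finite C" "C \<subseteq> Basis" "cube_pair w G" "\<And>x. x \<in> closed_cube \<Longrightarrow> w (- x) = - w x"
      "\<And>k x. k \<in> Basis - C \<Longrightarrow> x \<in> closed_cube \<Longrightarrow> w (flip k x) = w x" for C and w :: "'a \<Rightarrow> real" and G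
    using that
  proof (induction C arbitrary: w G)
    case empty
    have zero: "w x = 0" if x: "x \<in> closed_cube" for x
    proof -
      have reflect: "\<exists>y\<in>closed_cube. w y = w x \<and> (\<forall>k\<in>Basis. y \<bullet> k = (if k \<in> J then - (x \<bullet> k) else x \<bullet> k))"
        if "finite J" "J \<subseteq> Basis" for J
        using that
      proof induction
        case (insert j J)
        then obtain y where y: "y \<in> closed_cube" "w y = w x" "\<forall>k\<in>Basis. y \<bullet> k = (if k \<in> J then - (x \<bullet> k) else x \<bullet> k)"
          by auto
        then show ?case using insert empty.prems(4)[of j y]
          by (intro bexI[of _ "flip j y"]) (auto simp: inner_flip simp del: mem_box)
      qed (use x in auto)
      obtain y where "w y = w x" "\<forall>k\<in>Basis. y \<bullet> k = - (x \<bullet> k)"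
        using reflect[OF finite_Basis order_refl] by auto
      then have "y = - x" by (auto intro: euclidean_eqI[of y "- x"])
      then show ?thesis using \<open>w y = w x\<close> empty.prems(3)[OF x] by simp
    qed
    have "face_energy b w = (\<integral>\<^sup>+(x::'a). 0 \<partial>lborel)"
      unfolding face_energy_def
    proof (rule nn_integral_cong)
      fix x :: 'a
      show "indicator {0..1} (x \<bullet> b) * (indicator (strip b) x *
          ennreal ((w (coord_upd b 1 x))\<^sup>2 + (w (coord_upd b (-1) x))\<^sup>2)) = 0"
        using coord_upd_mem_closed_cube[OF b, of x 1] coord_upd_mem_closed_cube[OF b, of x "-1"]
        by (cases "x \<in> strip b") (simp_all add: zero)
    qed
    then show ?case by simp
  next
    case (insert j C)
    have j: "j \<in> Basis" using insert by auto
    note pair = insert.prems(2)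
    note flip_pair = cube_pair_flip[OF pair j]
    note [measurable] = cube_pairD(4,5)[OF pair]
    let ?e = "\<lambda>x. (1/2) * w x + (1/2) * w (flip j x)" and ?o = "\<lambda>x. (1/2) * w x + (-1/2) * w (flip j x)"
    let ?Ge = "\<lambda>x. (1/2) *\<^sub>R G x + (1/2) *\<^sub>R flip j (G (flip j x))"
    let ?Go = "\<lambda>x. (1/2) *\<^sub>R G x + (-1/2) *\<^sub>R flip j (G (flip j x))"
    have "face_energy b w = face_energy b ?e + face_energy b ?o"
      by (rule face_energy_parity[OF b j, symmetric]) measurable
    also have "\<dots> \<le> dirichlet_energy ?Ge + dirichlet_energy ?Go"
    proof (rule add_mono)
      show "face_energy b ?o \<le> dirichlet_energy ?Go"
        by (rule face_energy_le_of_odd_coordinate[OF cube_pair_combine[OF pair flip_pair] b j]) (use j in simp)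
      show "face_energy b ?e \<le> dirichlet_energy ?Ge"
      proof (rule insert.IH[OF _ cube_pair_combine[OF pair flip_pair]])
        show "C \<subseteq> Basis" using insert by auto
        show "?e (- x) = - ?e x" if "x \<in> closed_cube" for x
          using insert.prems(3)[OF that] insert.prems(3)[of "flip j x"] that j
          by (simp add: flip_uminus del: mem_box)
        show "?e (flip k x) = ?e x" if k: "k \<in> Basis - C" and x: "x \<in> closed_cube" for k x
        proof (cases "k = j")
          case False
          then have "k \<in> Basis - insert j C" using k by auto
          from insert.prems(4)[OF this x] insert.prems(4)[OF this, of "flip j x"] x j k
          show ?thesis by (simp add: flip_comm[of j k])
        qed (use j in simp)
      qed
    qed
    also have "\<dots> = dirichlet_energy G"
      by (rule dirichlet_energy_parity[OF j]) measurable
    finally show ?case .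
  qed
  from this[of Basis w G] w odd show ?thesis by auto
qed

section \<open>The best constants of the cube\<close>

lemma One_pos: "i \<in> Basis \<Longrightarrow> (- One :: 'a::euclidean_space) \<bullet> i < One \<bullet> i"
  by simp

lemma open_cube_subset: "open_cube \<subseteq> closed_cube"
  by (rule box_subset_cbox)

text \<open>
  An outer normal at \<open>x\<close> has no component along a direction in which one can move from \<open>x\<close> both ways
  inside the cube.
\<close>

lemma outer_normal_face:
  fixes x b :: "'a::euclidean_space"
  assumes b: "b \<in> Basis" and \<sigma>: "\<sigma> = 1 \<or> \<sigma> = -1" and xb: "x \<bullet> b = \<sigma>" and x: "x \<in> strip b"
  shows "outer_normal closed_cube x = \<sigma> *\<^sub>R b"
  unfolding outer_normal_def
proof (rule the_equality)
  show "norm (\<sigma> *\<^sub>R b) = 1 \<and> (\<forall>y\<in>closed_cube. \<sigma> *\<^sub>R b \<bullet> (y - x) \<le> 0)"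
    using b \<sigma> xb by (auto simp: mem_closed_cube inner_diff_right inner_commute[of b] abs_le_iff simp del: mem_box)
next
  fix v assume v: "norm v = 1 \<and> (\<forall>y\<in>closed_cube. v \<bullet> (y - x) \<le> 0)"
  have xc: "x \<in> closed_cube"
    using coord_upd_mem_closed_cube[OF b x, of \<sigma>] \<sigma> xb by (metis abs_1 abs_minus_cancel coord_upd_self order_refl)
  have slope: "(v \<bullet> k) * (s - x \<bullet> k) \<le> 0" if "k \<in> Basis" "\<bar>s\<bar> \<le> 1" for k s
  proof -
    have "coord_upd k s x \<in> closed_cube"
      using that xc by (simp add: mem_closed_cube inner_coord_upd)
    then have "v \<bullet> (coord_upd k s x - x) \<le> 0" using v by blast
    then show ?thesis by (simp add: coord_upd_def mult.commute)
  qed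
  have vk: "v \<bullet> k = 0" if k: "k \<in> Basis" "k \<noteq> b" for k
  proof -
    have "\<bar>x \<bullet> k\<bar> < 1" using x k by (auto simp: strip_def)
    then have "0 < 1 - x \<bullet> k" "-1 - x \<bullet> k < 0" by auto
    then show ?thesis using slope[OF k(1), of 1] slope[OF k(1), of "-1"]
      by (simp add: mult_le_0_iff)
  qed
  have veq: "v = (v \<bullet> b) *\<^sub>R b"
    using b vk by (intro euclidean_eqI[of v]) (auto simp: inner_Basis)
  then have "norm v = \<bar>v \<bullet> b\<bar>" using b by (metis mult.right_neutral norm_Basis norm_scaleR)
  then have "\<bar>v \<bullet> b\<bar> = 1" using v by simp
  moreover have "0 \<le> \<sigma> * (v \<bullet> b)" using slope[OF b, of 0] xb by (simp add: mult.commute)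
  ultimately have "v \<bullet> b = \<sigma>" using \<sigma> by (auto simp: abs_if split: if_splits)
  then show "v = \<sigma> *\<^sub>R b" using veq by simp
qed

lemma emeasure_lborel_hyperplane:
  fixes b :: "'a::euclidean_space"
  assumes b: "b \<in> Basis"
  shows "emeasure lborel {x. x \<bullet> b = c} = 0"
proof -
  have point: "(\<integral>\<^sup>+s. indicator {x. x \<bullet> b = c} (coord_upd b s x) \<partial>lborel) = (0::ennreal)" for x
  proof -
    have "(\<integral>\<^sup>+s. indicator {x. x \<bullet> b = c} (coord_upd b s x) \<partial>lborel) = (\<integral>\<^sup>+s. indicator {c} s \<partial>lborel)"
      using b by (intro nn_integral_cong) (simp add: indicator_def inner_coord_upd)
    then show ?thesis by simp
  qed
  have "emeasure lborel {x. x \<bullet> b = c} = (\<integral>\<^sup>+x. indicator {x. x \<bullet> b = c} x \<partial>lborel)"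
    by (rule nn_integral_indicator[symmetric]) measurable
  also have "\<dots> = (\<integral>\<^sup>+x. indicator {0..1} (x \<bullet> b) * (\<integral>\<^sup>+s. indicator {x. x \<bullet> b = c} (coord_upd b s x) \<partial>lborel) \<partial>lborel)"
    by (rule nn_integral_lborel_slice[OF b]) measurable
  finally show ?thesis by (simp only: point mult_zero_right nn_integral_const mult_zero_left)
qed

text \<open>
  The points at which the outer normal is not unique.
\<close>

definition cube_edges :: "'a::euclidean_space set" where
  "cube_edges = (\<Union>b\<in>Basis. \<Union>k\<in>Basis-{b}. \<Union>\<sigma>\<in>{1,-1}. {x\<in>closed_cube. x \<bullet> b = \<sigma> \<and> \<bar>x \<bullet> k\<bar> = 1})"

lemma AE_not_cube_edges: "AE x in hausdorff_measure (DIM('a) - 1). (x::'a::euclidean_space) \<notin> cube_edges"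
proof (rule AE_not_in)
  let ?H = "hausdorff_measure (DIM('a) - 1) :: 'a measure"
  have "{x\<in>closed_cube. x \<bullet> b = \<sigma> \<and> \<bar>x \<bullet> k\<bar> = 1} \<in> null_sets ?H" (is "?E \<in> _")
    if b: "b \<in> Basis" and k: "k \<in> Basis - {b}" for b k :: 'a and \<sigma> :: real
  proof -
    have "closed_cube \<inter> {x. x \<bullet> b = \<sigma> \<and> \<bar>x \<bullet> k\<bar> = 1} \<in> sets borel"
      by (intro sets.Int) (simp, measurable)
    then have [measurable]: "?E \<in> sets borel" by (simp add: Int_def del: mem_box)
    have "emeasure ?H ?E = emeasure (flat_measure b \<sigma>) ?E"
      by (rule hausdorff_measure_eq_flat_measure[OF b])
         (auto intro: bounded_subset[OF bounded_cbox[of "-One" One]] simp del: mem_box)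
    also have "\<dots> = emeasure lborel {x. x \<bullet> b \<in> {0..1} \<and> coord_upd b \<sigma> x \<in> ?E}"
      by (rule emeasure_flat_measure) measurable
    also have "\<dots> \<le> emeasure lborel ({x. x \<bullet> k = 1} \<union> {x. x \<bullet> k = -1})"
      using b k by (intro emeasure_mono) (auto simp: inner_coord_upd abs_if split: if_splits)
    also have "\<dots> \<le> emeasure lborel {x. x \<bullet> k = 1} + emeasure lborel {x. x \<bullet> k = -1}"
      by (rule emeasure_subadditive) measurable
    also have "\<dots> = 0" using k by (simp add: emeasure_lborel_hyperplane)
    finally show ?thesis by (intro null_setsI) auto
  qed
  then show "cube_edges \<in> null_sets ?H"
    unfolding cube_edges_def by (intro null_sets.finite_UN null_sets_UN') (auto intro: countable_finite)
qed

lemma grad_within_cube: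
  fixes u :: "'a::euclidean_space \<Rightarrow> real"
  assumes "x \<in> closed_cube" "(u has_derivative D) (at x within closed_cube)"
  shows "grad_within closed_cube u x = (\<Sum>k\<in>Basis. D k *\<^sub>R k)"
  unfolding grad_within_def using frechet_derivative_within_cbox[OF One_pos assms] by simp

lemma grad_within_odd:
  fixes u :: "'a::euclidean_space \<Rightarrow> real"
  assumes u: "u differentiable_on closed_cube" and even: "\<And>x. x \<in> closed_cube \<Longrightarrow> u (- x) = u x"
    and x: "x \<in> closed_cube"
  shows "grad_within closed_cube u (- x) = - grad_within closed_cube u x"
proof -
  have mx: "- y \<in> closed_cube" if "y \<in> closed_cube" for y :: 'a
    using that by (simp add: mem_closed_cube)
  obtain D where D: "(u has_derivative D) (at x within closed_cube)"
    using u x by (auto simp: differentiable_on_def differentiable_def simp del: mem_box)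
  have img: "uminus ` closed_cube = (closed_cube :: 'a set)"
    using mx by (force simp del: mem_box)
  have "((\<lambda>y. u (- y)) has_derivative (\<lambda>h. D (- h))) (at (- x) within closed_cube)"
    by (rule has_derivative_in_compose[where g=u and f=uminus]) (auto intro!: derivative_eq_intros simp: img D)
  then have "(u has_derivative (\<lambda>h. D (- h))) (at (- x) within closed_cube)"
    by (rule has_derivative_transform[OF mx[OF x], rotated]) (simp add: even)
  then have "grad_within closed_cube u (- x) = (\<Sum>k\<in>Basis. D (- k) *\<^sub>R k)"
    by (rule grad_within_cube[OF mx[OF x]])
  also have "\<dots> = (\<Sum>k\<in>Basis. - (D k *\<^sub>R k))"
    using linear_neg[OF has_derivative_linear[OF D]] by simp
  also have "\<dots> = - grad_within closed_cube u x"
    by (simp add: grad_within_cube[OF x D] sum_negf)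
  finally show ?thesis .
qed

text \<open>
  Cut off outside the cube, where the derivative within the cube is unspecified, to be measurable.
\<close>

definition grad_coord :: "('a::euclidean_space \<Rightarrow> real) \<Rightarrow> 'a \<Rightarrow> 'a \<Rightarrow> real" where
  "grad_coord u b x = indicator closed_cube x * (grad_within closed_cube u x \<bullet> b)"

lemma measurable_grad_coord:
  assumes "continuous_on closed_cube (grad_within closed_cube u)"
  shows "grad_coord u b \<in> borel_measurable borel"
proof -
  have "(\<lambda>x. indicator closed_cube x *\<^sub>R (grad_within closed_cube u x \<bullet> b)) \<in> borel_measurable borel"
    by (intro borel_measurable_continuous_on_indicator continuous_intros assms) simp
  then show ?thesis by (simp add: grad_coord_def[abs_def])
qed

text \<open>
  Off the null set of edges every boundary point lies on exactly one open face, and there the integrand is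
  the square of a partial derivative.
\<close>

lemma boundary_energy_cube:
  fixes u :: "'a::euclidean_space \<Rightarrow> real"
  assumes cont: "continuous_on closed_cube (grad_within closed_cube u)"
  shows "boundary_energy closed_cube u = (\<Sum>b\<in>Basis. face_energy b (grad_coord u b))"
proof -
  let ?K = "closed_cube :: 'a set"
  let ?H = "hausdorff_measure (DIM('a) - 1) :: 'a measure"
  define F where "F = (\<lambda>(b::'a) \<sigma>. {x. x \<bullet> b = \<sigma>} \<inter> strip b)"
  have [measurable]: "F b \<sigma> \<in> sets borel" for b \<sigma> unfolding F_def by measurable
  have [measurable]: "grad_coord u b \<in> borel_measurable borel" for b using cont by (rule measurable_grad_coord)
  define g where "g = (\<lambda>b x. ennreal ((grad_coord u b x)\<^sup>2))"
  have [measurable]: "g b \<in> borel_measurable borel" for b unfolding g_def by measurable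
  have FK: "x \<in> frontier ?K" if "x \<in> F b \<sigma>" "b \<in> Basis" "\<sigma> \<in> {1,-1}" for x b \<sigma>
  proof -
    have "coord_upd b \<sigma> x = x" using that by (auto simp: F_def coord_upd_def)
    then have "x \<in> ?K"
      using that coord_upd_mem_closed_cube[of b x \<sigma>] by (auto simp: F_def simp del: mem_box)
    moreover have "x \<notin> open_cube" using that by (auto simp: F_def mem_open_cube intro!: bexI[of _ b] simp del: mem_box)
    ultimately show ?thesis by (simp add: frontier_cbox)
  qed
  have pt: "ennreal ((grad_within ?K u x \<bullet> outer_normal ?K x)\<^sup>2 / (x \<bullet> outer_normal ?K x)) * indicator (frontier ?K) x
      = (\<Sum>b\<in>Basis. \<Sum>\<sigma>\<in>{1,-1}. g b x * indicator (F b \<sigma>) x)" if ne: "x \<notin> cube_edges" for x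
  proof (cases "x \<in> frontier ?K")
    case False
    then have "indicator (F b \<sigma>) x = (0::ennreal)" if "b \<in> Basis" "\<sigma> \<in> {1,-1}" for b \<sigma>
      using FK[of x b \<sigma>] that by (auto simp: indicator_def)
    then show ?thesis using False by simp
  next
    case True
    then have xK: "x \<in> ?K" and "x \<notin> open_cube" by (auto simp: frontier_cbox simp del: mem_box)
    then obtain b where b: "b \<in> Basis" "\<bar>x \<bullet> b\<bar> = 1" by (force simp: mem_closed_cube mem_open_cube simp del: mem_box)
    define \<sigma> where "\<sigma> = x \<bullet> b"
    have \<sigma>: "\<sigma> = 1 \<or> \<sigma> = -1" using b by (auto simp: \<sigma>_def abs_if split: if_splits)
    have strict: "\<bar>x \<bullet> k\<bar> < 1" if k: "k \<in> Basis" "k \<noteq> b" for k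
    proof -
      have "\<bar>x \<bullet> k\<bar> \<noteq> 1"
        using ne xK b(1) k \<sigma> unfolding cube_edges_def \<sigma>_def by auto
      moreover have "\<bar>x \<bullet> k\<bar> \<le> 1" using xK k unfolding mem_closed_cube by blast
      ultimately show ?thesis by simp
    qed
    then have xs: "x \<in> strip b" by (simp add: strip_def)
    have F: "x \<in> F k \<tau> \<longleftrightarrow> k = b \<and> \<tau> = \<sigma>" if "k \<in> Basis" "\<tau> \<in> {1,-1}" for k \<tau>
      using that strict[of k] xs by (cases "k = b") (auto simp: F_def \<sigma>_def)
    have "(\<Sum>k\<in>Basis. \<Sum>\<tau>\<in>{1,-1}. g k x * indicator (F k \<tau>) x)
        = (\<Sum>k\<in>Basis. \<Sum>\<tau>\<in>{1,-1}. if k = b \<and> \<tau> = \<sigma> then g b x else 0)"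
      using F by (intro sum.cong) (auto simp: indicator_def)
    also have "\<dots> = (\<Sum>k\<in>Basis. if k = b then g b x else 0)"
      using \<sigma> by (intro sum.cong) auto
    also have "\<dots> = g b x" using b by simp
    finally have R: "(\<Sum>k\<in>Basis. \<Sum>\<tau>\<in>{1,-1}. g k x * indicator (F k \<tau>) x) = g b x" .
    have "outer_normal ?K x = \<sigma> *\<^sub>R b" by (rule outer_normal_face[OF b(1) \<sigma> _ xs]) (simp add: \<sigma>_def)
    then show ?thesis
      unfolding R using True xK \<sigma> by (auto simp: g_def grad_coord_def \<sigma>_def[symmetric] simp del: mem_box)
  qed
  have face: "(\<integral>\<^sup>+x\<in>F b \<sigma>. g b x \<partial>?H)
      = (\<integral>\<^sup>+x. indicator {0..1} (x \<bullet> b) * (indicator (strip b) x * g b (coord_upd b \<sigma> x)) \<partial>lborel)"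
    if b: "b \<in> Basis" and \<sigma>: "\<sigma> \<in> {1,-1}" for b \<sigma>
  proof -
    have "bounded (F b \<sigma>)"
      using FK[OF _ b \<sigma>] by (intro bounded_subset[OF bounded_cbox[of "-One" One]]) (auto simp: frontier_cbox simp del: mem_box)
    then have "(\<integral>\<^sup>+x\<in>F b \<sigma>. g b x \<partial>?H)
      = (\<integral>\<^sup>+x. indicator {0..1} (x \<bullet> b) * (g b (coord_upd b \<sigma> x) * indicator (F b \<sigma>) (coord_upd b \<sigma> x)) \<partial>lborel)"
      by (intro nn_integral_hausdorff_measure_flat[OF b]) (auto simp: F_def)
    moreover have "indicator (F b \<sigma>) (coord_upd b \<sigma> x) = (indicator (strip b) x :: ennreal)" for x
      using b by (auto simp: F_def indicator_def strip_def inner_coord_upd)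
    ultimately show ?thesis by (simp add: mult.commute)
  qed
  have "boundary_energy ?K u = (\<integral>\<^sup>+x. (\<Sum>b\<in>Basis. \<Sum>\<sigma>\<in>{1,-1}. g b x * indicator (F b \<sigma>) x) \<partial>?H)"
    unfolding boundary_energy_def
    by (intro nn_integral_cong_AE) (use AE_not_cube_edges in \<open>eventually_elim, simp add: pt\<close>)
  also have "\<dots> = (\<Sum>b\<in>Basis. \<Sum>\<sigma>\<in>{1,-1}. \<integral>\<^sup>+x\<in>F b \<sigma>. g b x \<partial>?H)"
    by (subst nn_integral_sum, measurable, intro sum.cong refl nn_integral_sum) measurable
  also have "\<dots> = (\<Sum>b\<in>Basis. face_energy b (grad_coord u b))"
  proof (rule sum.cong[OF refl])
    fix b :: 'a assume b: "b \<in> Basis"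
    have "(\<Sum>\<sigma>\<in>{1,-1}. \<integral>\<^sup>+x\<in>F b \<sigma>. g b x \<partial>?H)
      = (\<integral>\<^sup>+x. indicator {0..1} (x \<bullet> b) * (indicator (strip b) x * g b (coord_upd b 1 x)) \<partial>lborel)
      + (\<integral>\<^sup>+x. indicator {0..1} (x \<bullet> b) * (indicator (strip b) x * g b (coord_upd b (-1) x)) \<partial>lborel)"
      using face[OF b, of 1] face[OF b, of "-1"] by simp
    also have "\<dots> = face_energy b (grad_coord u b)"
      unfolding face_energy_def g_def
      by (subst nn_integral_add[symmetric]) (auto simp: distrib_left)
    finally show "(\<Sum>\<sigma>\<in>{1,-1}. \<integral>\<^sup>+x\<in>F b \<sigma>. g b x \<partial>?H) = face_energy b (grad_coord u b)" .
  qed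
  finally show ?thesis .
qed

text \<open>
  The gradient of \<open>\<partial>\<^sub>c u\<close> in the interior.
\<close>

definition hessian_row :: "('a::euclidean_space \<Rightarrow> real) \<Rightarrow> 'a \<Rightarrow> 'a \<Rightarrow> 'a" where
  "hessian_row u c x = indicator open_cube x *\<^sub>R (\<Sum>b\<in>Basis. (hessian closed_cube u x b \<bullet> c) *\<^sub>R b)"

lemma cube_pair_grad_coord:
  fixes u :: "'a::euclidean_space \<Rightarrow> real"
  assumes u: "C2_interior closed_cube u" "C1_body closed_cube u"
  shows "cube_pair (grad_coord u c) (hessian_row u c)"
  unfolding cube_pair_def
proof (intro conjI ballI)
  let ?K = "closed_cube :: 'a set"
  have cont: "continuous_on ?K (grad_within ?K u)" using u by (simp add: C1_body_def)
  show "grad_coord u c \<in> borel_measurable borel" by (rule measurable_grad_coord[OF cont])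
  have "continuous_on ?K (\<lambda>x. grad_within ?K u x \<bullet> c)" by (intro continuous_intros cont)
  then show "continuous_on ?K (grad_coord u c)"
    by (rule continuous_on_eq) (simp add: grad_coord_def del: mem_box)
  have hc: "continuous_on open_cube (\<lambda>x. hessian ?K u x b)" if "b \<in> Basis" for b
    using u that by (simp add: C2_interior_def)
  have rc: "continuous_on open_cube (\<lambda>x. \<Sum>b\<in>Basis. (hessian ?K u x b \<bullet> c) *\<^sub>R b)"
    by (intro continuous_intros hc)
  then show "continuous_on open_cube (hessian_row u c)"
    by (rule continuous_on_eq) (simp add: hessian_row_def del: mem_box)
  show "hessian_row u c \<in> borel_measurable borel"
    unfolding hessian_row_def[abs_def] by (intro borel_measurable_continuous_on_indicator rc) simp
  fix x :: 'a assume x: "x \<in> open_cube"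
  have "grad_within ?K u differentiable at x"
    using u x by (simp add: C2_interior_def differentiable_on_def at_within_open[OF _ open_box] del: mem_box)
  then have D: "(grad_within ?K u has_derivative hessian ?K u x) (at x)"
    unfolding hessian_def by (simp add: frechet_derivative_works)
  have row: "hessian ?K u x h \<bullet> c = hessian_row u c x \<bullet> h" for h
  proof -
    have "hessian ?K u x h = hessian ?K u x (\<Sum>b\<in>Basis. (h \<bullet> b) *\<^sub>R b)" by (simp add: euclidean_representation)
    also have "\<dots> = (\<Sum>b\<in>Basis. (h \<bullet> b) *\<^sub>R hessian ?K u x b)"
      using has_derivative_linear[OF D] by (simp add: linear_sum linear_scale)
    finally have "hessian ?K u x h \<bullet> c = (\<Sum>b\<in>Basis. (h \<bullet> b) * (hessian ?K u x b \<bullet> c))"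
      by (simp add: inner_sum_left)
    also have "\<dots> = hessian_row u c x \<bullet> h"
      using x by (simp add: hessian_row_def inner_sum_left inner_commute[of h] mult.commute del: mem_box)
    finally show ?thesis .
  qed
  have "((\<lambda>x. grad_within ?K u x \<bullet> c) has_derivative (\<lambda>h. hessian ?K u x h \<bullet> c)) (at x)"
    by (intro has_derivative_inner_left D)
  then have "((\<lambda>x. grad_within ?K u x \<bullet> c) has_derivative (\<lambda>h. hessian_row u c x \<bullet> h)) (at x)"
    by (simp add: row)
  then show "(grad_coord u c has_derivative (\<lambda>h. hessian_row u c x \<bullet> h)) (at x)"
    by (rule has_derivative_transform_within_open[OF _ open_box x])
       (use open_cube_subset in \<open>auto simp: grad_coord_def simp del: mem_box\<close>)
qed

lemma hessian_energy_cube: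
  fixes u :: "'a::euclidean_space \<Rightarrow> real"
  assumes u: "C2_interior closed_cube u" "C1_body closed_cube u"
  shows "hessian_energy closed_cube u = (\<Sum>c\<in>Basis. dirichlet_energy (hessian_row u c))"
proof -
  let ?K = "closed_cube :: 'a set"
  note [measurable] = cube_pairD(5)[OF cube_pair_grad_coord[OF u]]
  have row: "(norm (hessian_row u c x))\<^sup>2 = (\<Sum>b\<in>Basis. (hessian ?K u x b \<bullet> c)\<^sup>2)" if "x \<in> open_cube" for x c
  proof -
    have "hessian_row u c x \<bullet> k = hessian ?K u x k \<bullet> c" if "k \<in> Basis" for k
      using \<open>x \<in> open_cube\<close> that by (simp add: hessian_row_def inner_sum_left inner_Basis if_distrib cong: if_cong del: mem_box)
    then show ?thesis
      unfolding power2_norm_eq_inner by (subst euclidean_inner) (simp add: power2_eq_square)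
  qed
  have "ennreal (hessian_hs_sq ?K u x) * indicator open_cube x
      = (\<Sum>c\<in>Basis. ennreal ((norm (hessian_row u c x))\<^sup>2) * indicator open_cube x)" for x
  proof (cases "x \<in> open_cube")
    case True
    then have "hessian_hs_sq ?K u x = (\<Sum>c\<in>Basis. (norm (hessian_row u c x))\<^sup>2)"
      unfolding hessian_hs_sq_def by (subst sum.swap) (simp add: row del: mem_box)
    then show ?thesis using True by (simp add: sum_ennreal del: mem_box)
  qed simp
  then have "hessian_energy ?K u = (\<integral>\<^sup>+x. (\<Sum>c\<in>Basis. ennreal ((norm (hessian_row u c x))\<^sup>2) * indicator open_cube x) \<partial>lborel)"
    unfolding hessian_energy_def interior_cbox by simp
  also have "\<dots> = (\<Sum>c\<in>Basis. dirichlet_energy (hessian_row u c))"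
    unfolding dirichlet_energy_def by (rule nn_integral_sum) measurable
  finally show ?thesis .
qed

theorem boundary_energy_le_hessian_energy:
  fixes u :: "'a::euclidean_space \<Rightarrow> real"
  assumes "u \<in> S0_even closed_cube"
  shows "boundary_energy closed_cube u \<le> hessian_energy closed_cube u"
proof -
  have u: "C2_interior closed_cube u" "C1_body closed_cube u" and even: "\<And>x. x \<in> closed_cube \<Longrightarrow> u (- x) = u x"
    using assms by (auto simp: S0_even_def simp del: mem_box)
  have "face_energy b (grad_coord u b) \<le> dirichlet_energy (hessian_row u b)" if "b \<in> Basis" for b
  proof (rule face_energy_le_dirichlet_energy[OF that cube_pair_grad_coord[OF u]])
    fix x :: 'a assume x: "x \<in> closed_cube"
    then have "- x \<in> closed_cube" by (simp add: mem_closed_cube)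
    then show "grad_coord u b (- x) = - grad_coord u b x"
      using grad_within_odd[of u x, OF _ even x] u x by (simp add: grad_coord_def C1_body_def del: mem_box)
  qed
  then show ?thesis
    using u by (simp add: boundary_energy_cube hessian_energy_cube C1_body_def sum_mono)
qed

text \<open>
  All second derivatives are constant, with sum of squares 8. On the faces orthogonal to \<open>p\<close> or \<open>q\<close> the normal
  derivative squared is 4, and the two faces of each direction together have the volume of the cube as
  their area.
\<close>

lemma saddle_energies:
  fixes p q :: "'a::euclidean_space"
  assumes pq: "p \<in> Basis" "q \<in> Basis" "p \<noteq> q"
  defines "u \<equiv> \<lambda>x. (x \<bullet> p)\<^sup>2 - (x \<bullet> q)\<^sup>2"
  shows "u \<in> S0_even closed_cube" "\<forall>x\<in>interior closed_cube. laplacian closed_cube u x = 0"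
    and "hessian_energy closed_cube u = 8 * emeasure lborel (open_cube :: 'a set)"
    and "8 * emeasure lborel (open_cube :: 'a set) \<le> boundary_energy closed_cube u"
proof -
  let ?K = "closed_cube :: 'a set"
  define L where "L = (\<lambda>x. (2 * (x \<bullet> p)) *\<^sub>R p - (2 * (x \<bullet> q)) *\<^sub>R q)"
  have Lb: "bounded_linear L"
    unfolding L_def by (intro bounded_linear_intros)
  have Du: "(u has_derivative (\<lambda>h. 2 * (x \<bullet> p) * (h \<bullet> p) - 2 * (x \<bullet> q) * (h \<bullet> q))) (at x within S)" for x S
    unfolding u_def by (auto intro!: derivative_eq_intros)
  have grad: "grad_within ?K u x = L x" if "x \<in> ?K" for x
  proof -
    have "grad_within ?K u x = (\<Sum>k\<in>Basis. (2 * (x \<bullet> p) * (k \<bullet> p) - 2 * (x \<bullet> q) * (k \<bullet> q)) *\<^sub>R k)"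
      by (rule grad_within_cube[OF that Du])
    also have "\<dots> = (\<Sum>k\<in>Basis. (L x \<bullet> k) *\<^sub>R k)"
      by (intro sum.cong) (auto simp: L_def inner_diff_left inner_commute[of _ p] inner_commute[of _ q])
    finally show ?thesis by (simp add: euclidean_representation)
  qed
  have DL: "(grad_within ?K u has_derivative L) (at x)" if "x \<in> open_cube" for x
    by (rule has_derivative_transform_within_open[OF bounded_linear_imp_has_derivative[OF Lb] open_box that])
       (use grad open_cube_subset in \<open>auto simp del: mem_box\<close>)
  have hess: "hessian ?K u x = L" if "x \<in> open_cube" for x
    unfolding hessian_def using frechet_derivative_at[OF DL[OF that]] by simp
  have Lk: "L b \<bullet> c = (if b = p \<and> c = p then 2 else 0) - (if b = q \<and> c = q then 2 else 0)"
    if "b \<in> Basis" "c \<in> Basis" for b c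
    using that pq by (auto simp: L_def inner_diff_left inner_Basis)
  have contL: "continuous_on S L" for S by (rule linear_continuous_on[OF Lb])
  have C1: "C1_body ?K u"
    unfolding C1_body_def
  proof
    show "u differentiable_on ?K" using Du by (auto simp: differentiable_on_def differentiable_def)
    show "continuous_on ?K (grad_within ?K u)"
      using contL by (rule continuous_on_eq) (simp add: grad del: mem_box)
  qed
  have C2: "C2_interior ?K u"
    unfolding C2_interior_def interior_cbox
  proof (intro conjI ballI)
    show "u differentiable_on open_cube" using Du by (auto simp: differentiable_on_def differentiable_def)
    show "grad_within ?K u differentiable_on open_cube"
      using DL by (meson differentiable_at_imp_differentiable_on differentiable_def)
    show "continuous_on open_cube (\<lambda>x. hessian ?K u x b)" for b
      using continuous_on_const by (rule continuous_on_eq) (simp add: hess del: mem_box)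
  qed
  show "u \<in> S0_even ?K" using C1 C2 by (simp add: S0_even_def u_def)
  show "\<forall>x\<in>interior ?K. laplacian ?K u x = 0"
    using pq by (simp add: laplacian_def interior_cbox hess Lk sum_subtractf del: mem_box)
  have hs: "hessian_hs_sq ?K u x = 8" if "x \<in> open_cube" for x
  proof -
    have "(\<Sum>c\<in>Basis. (L b \<bullet> c)\<^sup>2) = (if b = p then 4 else 0) + (if b = q then 4 else 0)" if b: "b \<in> Basis" for b
    proof -
      have "(\<Sum>c\<in>Basis. (L b \<bullet> c)\<^sup>2)
          = (\<Sum>c\<in>Basis. (if c = p then (if b = p then 4 else 0) else 0) + (if c = q then (if b = q then 4 else 0) else 0))"
        using b pq by (intro sum.cong) (auto simp: Lk)
      then show ?thesis using pq by (simp add: sum.distrib)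
    qed
    then show ?thesis using that pq by (simp add: hessian_hs_sq_def hess sum.distrib del: mem_box)
  qed
  have "hessian_energy ?K u = (\<integral>\<^sup>+x. 8 * indicator (open_cube :: 'a set) x \<partial>lborel)"
    unfolding hessian_energy_def interior_cbox
    by (intro nn_integral_cong) (auto simp: indicator_def hs simp del: mem_box)
  then show "hessian_energy ?K u = 8 * emeasure lborel (open_cube :: 'a set)"
    by (simp add: nn_integral_cmult)
  have vol: "emeasure lborel (open_cube :: 'a set)
      = 2 * (\<integral>\<^sup>+x. indicator {0..1} (x \<bullet> b) * indicator (strip b) x \<partial>lborel)" if b: "b \<in> Basis" for b :: 'a
  proof -
    have "emeasure lborel (open_cube :: 'a set) = (\<integral>\<^sup>+x. 1 * indicator (open_cube :: 'a set) x \<partial>lborel)" by simp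
    also have "\<dots> = (\<integral>\<^sup>+x. indicator {0..1} (x \<bullet> b) *
     (indicator (strip b) x * (\<integral>\<^sup>+s. 1 * indicator {-1<..<1::real} s \<partial>lborel)) \<partial>lborel)"
      by (rule nn_integral_open_cube_slice[OF b]) measurable
    also have "\<dots> = (\<integral>\<^sup>+x. 2 * (indicator {0..1} (x \<bullet> b) * indicator (strip b) x) \<partial>lborel)"
      by (intro nn_integral_cong) (simp add: mult_ac)
    finally show ?thesis by (simp add: nn_integral_cmult)
  qed
  have face: "face_energy b (grad_coord u b) = 4 * emeasure lborel (open_cube :: 'a set)" if b: "b = p \<or> b = q" for b
  proof -
    have bB: "b \<in> Basis" using b pq by auto
    have "(grad_coord u b (coord_upd b s x))\<^sup>2 = 4" if x: "x \<in> strip b" and s: "s = 1 \<or> s = -1" for s x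
    proof -
      have m: "coord_upd b s x \<in> ?K" using s by (intro coord_upd_mem_closed_cube[OF bB x]) auto
      have "(L (coord_upd b s x) \<bullet> b)\<^sup>2 = 4"
        using b pq s by (auto simp: L_def inner_diff_left inner_Basis inner_coord_upd)
      then show ?thesis using m by (simp add: grad_coord_def grad del: mem_box)
    qed
    then have "face_energy b (grad_coord u b) = (\<integral>\<^sup>+x. 8 * (indicator {0..1} (x \<bullet> b) * indicator (strip b) x) \<partial>lborel)"
      unfolding face_energy_def by (intro nn_integral_cong) (auto simp: indicator_def)
    also have "\<dots> = 8 * (\<integral>\<^sup>+x. indicator {0..1} (x \<bullet> b) * indicator (strip b) x \<partial>lborel)"
      by (rule nn_integral_cmult) measurable
    also have "\<dots> = 4 * emeasure lborel (open_cube :: 'a set)"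
      unfolding vol[OF bB] by (simp add: mult.assoc[symmetric])
    finally show ?thesis .
  qed
  have "8 * emeasure lborel (open_cube :: 'a set) = (\<Sum>b\<in>{p, q}. face_energy b (grad_coord u b))"
    using pq by (simp add: face distrib_right[symmetric])
  also have "\<dots> \<le> (\<Sum>b\<in>Basis. face_energy b (grad_coord u b))"
    using pq by (intro sum_mono2) auto
  also have "\<dots> = boundary_energy ?K u"
    using C1 by (simp add: boundary_energy_cube C1_body_def)
  finally show "8 * emeasure lborel (open_cube :: 'a set) \<le> boundary_energy ?K u" .
qed

lemma emeasure_open_cube:
  "0 < emeasure lborel (open_cube :: 'a::euclidean_space set)" "emeasure lborel (open_cube :: 'a set) < \<infinity>"
proof -
  have "emeasure lborel (open_cube :: 'a set) = ennreal (\<Prod>b\<in>Basis. (One - (- One)) \<bullet> (b::'a))"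
    by (rule emeasure_lborel_box) simp
  also have "(\<Prod>b\<in>Basis. (One - (- One)) \<bullet> (b::'a)) = 2 ^ DIM('a)" by (simp add: inner_add_left)
  finally show "0 < emeasure lborel (open_cube :: 'a set)" "emeasure lborel (open_cube :: 'a set) < \<infinity>"
    by simp_all
qed

theorem best_constants_cube:
  assumes dim: "2 \<le> DIM('a::euclidean_space)"
  shows "B_H_const (closed_cube :: 'a set) = 1" "B_const (closed_cube :: 'a set) = 1"
proof -
  let ?K = "closed_cube :: 'a set"
  have upper: "B_const ?K \<le> 1"
    unfolding B_const_def best_constant_def by (rule Inf_lower) (simp add: boundary_energy_le_hessian_energy)
  have mono: "B_H_const ?K \<le> B_const ?K"
    unfolding B_const_def B_H_const_def best_constant_def by (rule Inf_superset_mono) auto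
  have lower: "1 \<le> B_H_const ?K"
  proof -
    obtain p where p: "p \<in> (Basis :: 'a set)" using nonempty_Basis by blast
    have "(Basis :: 'a set) \<noteq> {p}" using dim by (metis One_nat_def card.empty card.insert empty_iff finite.emptyI not_less_eq_eq numeral_2_eq_2 order_refl)
    then obtain q where q: "q \<in> (Basis :: 'a set)" "q \<noteq> p" using p by blast
    define u where "u = (\<lambda>x::'a. (x \<bullet> p)\<^sup>2 - (x \<bullet> q)\<^sup>2)"
    note s = saddle_energies[OF p q(1) q(2)[symmetric], folded u_def]
    let ?V = "8 * emeasure lborel (open_cube :: 'a set)"
    have nontrivial: "8 * e \<noteq> 0 \<and> 8 * e \<noteq> top" if "0 < e" "e < \<infinity>" for e :: ennreal
      using that by (auto simp: ennreal_mult_eq_top_iff)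
    have V: "?V \<noteq> 0" "?V \<noteq> top"
      using nontrivial[OF emeasure_open_cube] by blast+
    show ?thesis
      unfolding B_H_const_def best_constant_def
    proof (rule Inf_greatest)
      fix B assume "B \<in> {B. \<forall>v\<in>{v \<in> S0_even ?K. \<forall>x\<in>interior ?K. laplacian ?K v x = 0}.
        boundary_energy ?K v \<le> B * hessian_energy ?K v}"
      then have "boundary_energy ?K u \<le> B * hessian_energy ?K u" using s(1,2) by blast
      then have "?V * 1 \<le> ?V * B"
        using order_trans[OF s(4)] unfolding s(3) mult_1_right mult.commute[of _ B] by blast
      then show "1 \<le> B" using ennreal_mult_le_mult_iff[OF V] by blast
    qed
  qed
  show "B_H_const ?K = 1" "B_const ?K = 1" using upper mono lower by (auto intro: antisym)
qed

lemma unit_cube_eq: "(unit_cube :: (real ^ 'n) set) = closed_cube"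
proof -
  have "x \<in> closed_cube \<longleftrightarrow> (\<forall>i. \<bar>x $ i\<bar> \<le> 1)" for x :: "real ^ 'n"
    unfolding mem_closed_cube by (auto simp: Basis_vec_def inner_axis)
  then show ?thesis unfolding unit_cube_def set_eq_iff by (simp add: abs_le_iff minus_le_iff conj_commute)
qed

theorem theorem8p5:
  assumes "CARD('n::finite) \<ge> 2"
  shows "B_H_const (unit_cube :: (real ^ 'n) set) = 1 \<and> B_const (unit_cube :: (real ^ 'n) set) = 1"
  unfolding unit_cube_eq using best_constants_cube[where 'a="real ^ 'n"] assms by simp

end
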